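(* Let $r, d$ be positive integers and let $\mathcal{F}$ be a family of $(r-1)\left(\frac{d(d+3)}{2}+1\right)+1$ sets in $\mathbb{R}^d$, each of volume one. Then there exists a partition of $\mathcal{F}$ into $r$ parts $\mathcal{A}_1, \ldots, \mathcal{A}_r$ such that the volume of $\bigcap_{j=1}^r \operatorname{conv}\left(\bigcup \mathcal{A}_j\right)$ is at least $d^{-d}$.
   Context: $\operatorname{conv}$ denotes the convex hull, and $\bigcup \mathcal{A}_j$ denotes the union of the sets in $\mathcal{A}_j$. Volume means $d$-dimensional Lebesgue measure. *)

theory Defs
  imports "HOL-Analysis.Analysis"
begin

end

theory Submission
  imports Defs
begin

text \<open>
  By John's theorem the convex hull of a set of volume one contains an ellipsoid \<open>{a + A y | y. norm y < 1}\<close>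
  of volume at least \<open>d\<^sup>-\<^sup>d\<close>, where \<open>A\<close> may be taken symmetric and positive semidefinite. The pair
  \<open>(A, a)\<close> is a point in a space of dimension \<open>d (d + 3) / 2\<close>, so Tverberg's theorem partitions these
  points into \<open>r\<close> parts whose convex hulls share a point \<open>(S, s)\<close>. The ellipsoid of \<open>(S, s)\<close> is contained
  in the convex hull of the union of each part, and its volume is at least \<open>d\<^sup>-\<^sup>d\<close> because the determinant is
  quasi-concave on positive semidefinite matrices. Tverberg's theorem is obtained from the colourful
  Caratheodory theorem by Sarkaria's tensor trick.
\<close>

section \<open>Tverberg's theorem\<close>

text \<open>The bound \<open>d^(-d)\<close> is the loss in John's theorem: a convex body lies in the
  d-fold dilate, about the centre, of its largest inscribed ellipsoid. The absolute value of the
  determinant is not quasi-concave on all matrices: the midpoint of \<open>mat 1\<close> and a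
  reflection is singular. An arbitrary matrix for each ellipsoid is therefore not enough, and the
  freedom to replace A by A Q with Q orthogonal is spent on making A positive semidefinite. The same
  choice shortens the list of coordinates from \<open>d^2 + d\<close> to d (d + 3) / 2. Containment
  survives convex combinations because a + A y is linear in (A, a) for each fixed y. The hull of a
  measurable set may be neither closed nor bounded. John's theorem is therefore applied to a compact
  convex part of its closure, and the open ellipsoid is brought back into the hull because a convex
  set and its closure have the same interior.\<close>

lemma homogeneous_system_nontrivial_solution:
  fixes m :: "'i \<Rightarrow> 'k \<Rightarrow> real"
  assumes "finite K" "finite I" "card K < card I"
  shows "\<exists>\<beta>. (\<exists>i\<in>I. \<beta> i \<noteq> 0) \<and> (\<forall>k\<in>K. (\<Sum>i\<in>I. \<beta> i * m i k) = 0)"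
  using assms
proof (induction K arbitrary: I m rule: finite_induct)
  case empty
  then have "I \<noteq> {}" by auto
  then show ?case by (intro exI[of _ "\<lambda>_. 1"]) auto
next
  case (insert k K)
  show ?case
  proof (cases "\<forall>i\<in>I. m i k = 0")
    case True
    obtain \<beta> where "\<exists>i\<in>I. \<beta> i \<noteq> 0" "\<forall>l\<in>K. (\<Sum>i\<in>I. \<beta> i * m i l) = 0"
      using insert.IH[of I m] insert.prems insert.hyps by auto
    then show ?thesis using True by (intro exI[of _ \<beta>]) auto
  next
    case False
    then obtain i0 where i0: "i0 \<in> I" "m i0 k \<noteq> 0" by auto
    define J where "J = I - {i0}"
    \<comment> \<open>Gaussian elimination with pivot \<open>m i0 k\<close>: \<open>m'\<close> is
      the system left after the unknown of index \<open>i0\<close> is eliminated, and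
      \<open>- s\<close> below is the value of that unknown recovered from equation
      \<open>k\<close>.\<close>
    define m' where "m' i l = m i l - m i k / m i0 k * m i0 l" for i l
    have "card K < card J" "finite J"
      using insert.prems insert.hyps i0 by (auto simp: J_def)
    then obtain \<beta> where \<beta>: "\<exists>i\<in>J. \<beta> i \<noteq> 0" "\<And>l. l \<in> K \<Longrightarrow> (\<Sum>i\<in>J. \<beta> i * m' i l) = 0"
      using insert.IH[of J m'] by auto
    define s where "s = (\<Sum>i\<in>J. \<beta> i * m i k) / m i0 k"
    define \<gamma> where "\<gamma> i = (if i = i0 then - s else \<beta> i)" for i
    have split: "(\<Sum>i\<in>I. \<gamma> i * m i l) = - s * m i0 l + (\<Sum>i\<in>J. \<beta> i * m i l)" for l
    proof -
      have "(\<Sum>i\<in>I. \<gamma> i * m i l) = \<gamma> i0 * m i0 l + (\<Sum>i\<in>J. \<gamma> i * m i l)"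
        unfolding J_def using insert.prems i0 by (intro sum.remove) auto
      also have "(\<Sum>i\<in>J. \<gamma> i * m i l) = (\<Sum>i\<in>J. \<beta> i * m i l)"
        by (rule sum.cong) (auto simp: \<gamma>_def J_def)
      finally show ?thesis by (simp add: \<gamma>_def)
    qed
    have "(\<Sum>i\<in>I. \<gamma> i * m i l) = 0" if "l \<in> insert k K" for l
    proof (cases "l = k")
      case True
      then show ?thesis unfolding split using i0 by (simp add: s_def)
    next
      case False
      then have "0 = (\<Sum>i\<in>J. \<beta> i * m' i l)" using \<beta>(2) that by auto
      also have "\<dots> = (\<Sum>i\<in>J. \<beta> i * m i l) - s * m i0 l"
        by (simp add: m'_def right_diff_distrib sum_subtractf s_def sum_divide_distrib sum_distrib_right mult.assoc)
      finally show ?thesis unfolding split by simp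
    qed
    moreover have "\<exists>i\<in>I. \<gamma> i \<noteq> 0" using \<beta>(1) by (auto simp: \<gamma>_def J_def)
    ultimately show ?thesis by blast
  qed
qed

text \<open>First-order optimality condition, obtained by letting t tend to 0. It serves the nearest
  point in the colourful theorem, the maximum of the Rayleigh quotient and the infinitesimal
  rotation of a trace-maximal matrix.\<close>

lemma nonneg_if_nonneg_perturbations:
  fixes a b :: real
  assumes "\<And>t. 0 < t \<Longrightarrow> t \<le> 1 \<Longrightarrow> 0 \<le> a + t * b"
  shows "0 \<le> a"
proof (rule tendsto_lowerbound)
  show "((\<lambda>t. a + t * b) \<longlongrightarrow> a) (at_right 0)"
    by (auto intro!: tendsto_eq_intros)
  have "\<forall>\<^sub>F t::real in at_right 0. 0 < t \<and> t < 1"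
    using eventually_at_right_real[of 0 1] by (auto elim: eventually_mono)
  then show "\<forall>\<^sub>F t in at_right 0. 0 \<le> a + t * b"
    by (rule eventually_mono) (use assms in auto)
qed auto

text \<open>Weights are total functions on a possibly infinite index type. Fixing them to 0 off
  \<open>I\<close> places them in a product of compact sets, so that Tychonoff's theorem
  applies.\<close>

lemma compact_standard_simplex:
  fixes I :: "'i set"
  assumes "finite I"
  shows "compact {\<alpha> :: 'i \<Rightarrow> real. (\<forall>i\<in>I. 0 \<le> \<alpha> i) \<and> sum \<alpha> I = 1 \<and> (\<forall>i. i \<notin> I \<longrightarrow> \<alpha> i = 0)}"
    (is "compact ?D")
proof -
  let ?P = "PiE UNIV (\<lambda>i. if i \<in> I then {0..1} else {0}) :: ('i \<Rightarrow> real) set"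
  have "compactin (product_topology (\<lambda>_. euclidean) UNIV) ?P"
    unfolding compactin_PiE by auto
  then have "compact ?P"
    by (simp add: euclidean_product_topology)
  moreover have "closed {\<alpha> :: 'i \<Rightarrow> real. sum \<alpha> I = 1}"
    by (intro closed_Collect_eq continuous_intros continuous_on_product_coordinates)
  ultimately have "compact (?P \<inter> {\<alpha>. sum \<alpha> I = 1})"
    by (rule compact_Int_closed)
  moreover have "?D = ?P \<inter> {\<alpha>. sum \<alpha> I = 1}"
  proof (intro equalityI subsetI)
    fix \<alpha> assume "\<alpha> \<in> ?D"
    moreover from this have "\<alpha> i \<le> 1" if "i \<in> I" for i
      using member_le_sum[of i I \<alpha>] assms that by auto
    ultimately show "\<alpha> \<in> ?P \<inter> {\<alpha>. sum \<alpha> I = 1}" by (auto simp: PiE_iff)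
  next
    fix \<alpha> assume "\<alpha> \<in> ?P \<inter> {\<alpha>. sum \<alpha> I = 1}"
    then have "\<alpha> i \<in> (if i \<in> I then {0..1} else {0})" "sum \<alpha> I = 1" for i
      by (auto simp: PiE_iff)
    then show "\<alpha> \<in> ?D" by (fastforce split: if_splits)
  qed
  ultimately show ?thesis by simp
qed

text \<open>Take the choice of colours whose convex hull comes closest to the origin. If the nearest point
  \<open>p\<close> is nonzero, it lies in the hull of the vectors of fewer than \<open>card I\<close> indices, so some index is free to be
  recoloured towards the origin.\<close>

theorem colourful_caratheodory:
  fixes v :: "'i \<Rightarrow> 'c \<Rightarrow> 'k \<Rightarrow> real"
  assumes "finite K" "finite I" "card K < card I" "finite C" "C \<noteq> {}"
    and zero: "\<And>i k. i \<in> I \<Longrightarrow> k \<in> K \<Longrightarrow> (\<Sum>c\<in>C. v i c k) = 0"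
  shows "\<exists>f \<alpha>. f ` I \<subseteq> C \<and> (\<forall>i\<in>I. 0 \<le> \<alpha> i) \<and> sum \<alpha> I = 1 \<and>
           (\<forall>k\<in>K. (\<Sum>i\<in>I. \<alpha> i * v i (f i) k) = 0)"
proof -
  define S where "S f \<alpha> k = (\<Sum>i\<in>I. \<alpha> i * v i (f i) k)" for f and \<alpha> :: "'i \<Rightarrow> real" and k
  define Q where "Q f \<alpha> = (\<Sum>k\<in>K. (S f \<alpha> k)\<^sup>2)" for f and \<alpha> :: "'i \<Rightarrow> real"
  define D where "D = {\<alpha> :: 'i \<Rightarrow> real. (\<forall>i\<in>I. 0 \<le> \<alpha> i) \<and> sum \<alpha> I = 1 \<and> (\<forall>i. i \<notin> I \<longrightarrow> \<alpha> i = 0)}"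
  define \<Phi> where "\<Phi> = PiE I (\<lambda>_. C)"
  obtain i1 where i1: "i1 \<in> I" using assms(3) by fastforce
  have "compact D" unfolding D_def by (rule compact_standard_simplex[OF \<open>finite I\<close>])
  moreover have "(\<lambda>i. if i = i1 then 1 else 0) \<in> D"
    using i1 assms(2) by (auto simp: D_def)
  moreover have "continuous_on D (Q f)" for f
    unfolding Q_def S_def by (intro continuous_intros continuous_on_product_coordinates)
      (rule continuous_on_subset[OF continuous_on_product_coordinates]; simp)
  ultimately have "\<exists>\<alpha>\<in>D. \<forall>\<beta>\<in>D. Q f \<alpha> \<le> Q f \<beta>" for f
    by (intro continuous_attains_inf) auto
  then obtain a where a: "\<And>f. a f \<in> D" "\<And>f \<beta>. \<beta> \<in> D \<Longrightarrow> Q f (a f) \<le> Q f \<beta>" by metis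
  have "finite \<Phi>" "\<Phi> \<noteq> {}"
    using assms by (auto simp: \<Phi>_def finite_PiE PiE_eq_empty_iff)
  then obtain f where f: "f \<in> \<Phi>" "\<And>g. g \<in> \<Phi> \<Longrightarrow> Q f (a f) \<le> Q g (a g)"
    using arg_min_if_finite[of \<Phi> "\<lambda>f. Q f (a f)"] by (metis leI)
  define q where "q = Q f (a f)"
  have q_le: "q \<le> Q g \<beta>" if "g \<in> \<Phi>" "\<beta> \<in> D" for g \<beta>
    using f(2)[OF that(1)] a(2)[OF that(2), of g] by (simp add: q_def)
  have vertex: "q \<le> (\<Sum>k\<in>K. S g \<alpha> k * v i (g i) k)"
    if "g \<in> \<Phi>" "\<alpha> \<in> D" "Q g \<alpha> = q" "i \<in> I" for g \<alpha> i
  proof -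
    define w where "w = (\<Sum>k\<in>K. S g \<alpha> k * v i (g i) k)"
    define n where "n = (\<Sum>k\<in>K. (v i (g i) k)\<^sup>2)"
    have "0 \<le> 2 * (w - q) + t * (q - 2 * w + n)" if t: "0 < t" "t \<le> 1" for t
    proof -
      define \<beta> where "\<beta> l = (1 - t) * \<alpha> l + t * (if l = i then 1 else 0)" for l
      have "\<beta> \<in> D" using \<open>\<alpha> \<in> D\<close> t \<open>i \<in> I\<close> \<open>finite I\<close>
        by (auto simp: D_def \<beta>_def sum.distrib sum_distrib_left[symmetric])
      then have le: "q \<le> Q g \<beta>" using q_le \<open>g \<in> \<Phi>\<close> by blast
      have S\<beta>: "S g \<beta> k = (1 - t) * S g \<alpha> k + t * v i (g i) k" for k
      proof -
        have "S g \<beta> k = (\<Sum>l\<in>I. (1 - t) * (\<alpha> l * v l (g l) k) + (if l = i then t * v l (g l) k else 0))"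
          unfolding S_def \<beta>_def by (rule sum.cong) (auto simp: algebra_simps)
        then show ?thesis using \<open>i \<in> I\<close> \<open>finite I\<close>
          by (simp add: sum.distrib S_def sum_distrib_left)
      qed
      have "Q g \<beta> = (\<Sum>k\<in>K. (1 - t)\<^sup>2 * (S g \<alpha> k)\<^sup>2 + 2 * t * (1 - t) * (S g \<alpha> k * v i (g i) k) + t\<^sup>2 * (v i (g i) k)\<^sup>2)"
        unfolding Q_def S\<beta> by (intro sum.cong) (auto simp: power2_eq_square algebra_simps)
      also have "\<dots> = (1 - t)\<^sup>2 * q + 2 * t * (1 - t) * w + t\<^sup>2 * n"
        using \<open>Q g \<alpha> = q\<close> by (simp add: sum.distrib sum_distrib_left[symmetric] w_def n_def Q_def)
      finally have "0 \<le> t * (2 * (w - q) + t * (q - 2 * w + n))"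
        using le by (simp add: power2_eq_square algebra_simps)
      with t show ?thesis by (simp add: zero_le_mult_iff)
    qed
    then have "0 \<le> 2 * (w - q)" by (rule nonneg_if_nonneg_perturbations)
    then show ?thesis by (simp add: w_def)
  qed
  have "q = 0"
  proof (rule ccontr)
    assume "q \<noteq> 0"
    moreover have "q \<ge> 0" by (simp add: q_def Q_def sum_nonneg)
    ultimately have "q > 0" by simp
    have "\<exists>\<alpha>\<in>D. Q f \<alpha> = q \<and> (\<exists>i\<in>I. \<alpha> i = 0)"
    proof (rule ccontr)
      assume contr: "\<not> ?thesis"
      define \<alpha> where "\<alpha> = a f"
      have \<alpha>: "\<alpha> \<in> D" "Q f \<alpha> = q" using a by (auto simp: \<alpha>_def q_def)
      with contr have pos: "\<alpha> i > 0" if "i \<in> I" for i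
        using that by (force simp: D_def less_le)
      \<comment> \<open>The average of \<open>w\<close> with weights \<open>\<alpha>\<close> is
        \<open>q\<close> and no value is below \<open>q\<close>, so all values are \<open>q\<close>:
        the vectors lie on one hyperplane missing the origin. A linear dependency among them then
        has coefficient sum 0, which is why \<open>card K < card I\<close> suffices here.\<close>
      define w where "w i = (\<Sum>k\<in>K. S f \<alpha> k * v i (f i) k)" for i
      have "(\<Sum>i\<in>I. \<alpha> i * w i) = (\<Sum>k\<in>K. S f \<alpha> k * S f \<alpha> k)"
        unfolding w_def S_def[of f \<alpha>] sum_distrib_left sum_distrib_right
        by (subst sum.swap) (auto intro!: sum.cong simp: algebra_simps)
      then have "(\<Sum>i\<in>I. \<alpha> i * w i) = q"
        using \<alpha> by (simp add: Q_def power2_eq_square)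
      then have "(\<Sum>i\<in>I. \<alpha> i * (w i - q)) = 0"
        using \<alpha> by (simp add: D_def right_diff_distrib sum_subtractf sum_distrib_right[symmetric])
      moreover have "\<alpha> i * (w i - q) \<ge> 0" if "i \<in> I" for i
        using vertex[OF f(1) \<alpha> that] pos[OF that] by (simp add: w_def)
      ultimately have wq: "w i = q" if "i \<in> I" for i
        using sum_nonneg_eq_0_iff[OF \<open>finite I\<close>, of "\<lambda>i. \<alpha> i * (w i - q)"] that pos[OF that] by auto
      obtain \<beta> where \<beta>: "\<exists>i\<in>I. \<beta> i \<noteq> 0" "\<And>k. k \<in> K \<Longrightarrow> (\<Sum>i\<in>I. \<beta> i * v i (f i) k) = 0"
        using homogeneous_system_nontrivial_solution[OF assms(1-3), of "\<lambda>i. v i (f i)"] by auto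
      have "(\<Sum>i\<in>I. \<beta> i * w i) = (\<Sum>k\<in>K. S f \<alpha> k * (\<Sum>i\<in>I. \<beta> i * v i (f i) k))"
        unfolding w_def sum_distrib_left
        by (subst sum.swap) (auto intro!: sum.cong simp: algebra_simps)
      also have "\<dots> = 0" using \<beta>(2) by simp
      finally have "(\<Sum>i\<in>I. \<beta> i) * q = 0" using wq by (simp add: sum_distrib_right)
      then have \<beta>0: "sum \<beta> I = 0" using \<open>q > 0\<close> by simp
      define N where "N = {i\<in>I. \<beta> i < 0}"
      have "N \<noteq> {}"
      proof
        assume "N = {}"
        then have "\<forall>i\<in>I. 0 \<le> \<beta> i" by (auto simp: N_def not_less)
        then have "\<forall>i\<in>I. \<beta> i = 0" using \<beta>0 \<open>finite I\<close> by (simp add: sum_nonneg_eq_0_iff)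
        with \<beta>(1) show False by auto
      qed
      moreover have "finite N" using \<open>finite I\<close> by (simp add: N_def)
      ultimately obtain l where l: "l \<in> N" "\<And>i. i \<in> N \<Longrightarrow> \<alpha> l / (- \<beta> l) \<le> \<alpha> i / (- \<beta> i)"
        using arg_min_if_finite[of N "\<lambda>i. \<alpha> i / (- \<beta> i)"] by (metis leI)
      \<comment> \<open>The largest step along \<open>\<beta>\<close> that keeps all weights
        nonnegative; the weight at \<open>l\<close> reaches 0 while the point and the total weight
        stay fixed.\<close>
      define t where "t = \<alpha> l / (- \<beta> l)"
      have lI: "l \<in> I" "\<beta> l < 0" using l by (auto simp: N_def)
      have "t > 0" using lI pos[of l] by (simp add: t_def divide_pos_neg)
      define \<gamma> where "\<gamma> i = (if i \<in> I then \<alpha> i + t * \<beta> i else 0)" for i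
      have "0 \<le> \<gamma> i" if "i \<in> I" for i
      proof (cases "\<beta> i < 0")
        case True
        then have "t \<le> \<alpha> i / (- \<beta> i)" using l(2)[of i] that by (auto simp: N_def t_def)
        then show ?thesis using True that by (simp add: \<gamma>_def field_simps)
      next
        case False
        then show ?thesis using pos[OF that] \<open>t > 0\<close> by (simp add: \<gamma>_def)
      qed
      moreover have "sum \<gamma> I = 1"
        using \<alpha> \<beta>0 by (simp add: \<gamma>_def sum.distrib sum_distrib_left[symmetric] D_def)
      ultimately have "\<gamma> \<in> D" by (auto simp: D_def \<gamma>_def)
      moreover have "S f \<gamma> k = S f \<alpha> k" if "k \<in> K" for k
      proof -
        have "S f \<gamma> k = S f \<alpha> k + t * (\<Sum>i\<in>I. \<beta> i * v i (f i) k)"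
          unfolding S_def \<gamma>_def
          by (simp add: sum_distrib_left sum.distrib[symmetric] algebra_simps)
        then show ?thesis using \<beta>(2)[OF that] by simp
      qed
      then have "Q f \<gamma> = q" using \<alpha> by (simp add: Q_def)
      moreover have "\<gamma> l = 0" using lI by (simp add: \<gamma>_def t_def)
      ultimately show False using contr lI by blast
    qed
    then obtain \<alpha> i0 where \<alpha>: "\<alpha> \<in> D" "Q f \<alpha> = q" "i0 \<in> I" "\<alpha> i0 = 0" by auto
    \<comment> \<open>The vectors at \<open>i0\<close> sum to 0 over the colours, so one of them has
      nonpositive inner product with the nearest point. Recolouring \<open>i0\<close> with it leaves
      the point unchanged, as the weight there is 0, and contradicts \<open>vertex\<close>.\<close>
    have "(\<Sum>c\<in>C. \<Sum>k\<in>K. S f \<alpha> k * v i0 c k) = 0"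
      by (subst sum.swap) (simp add: sum_distrib_left[symmetric] zero \<alpha>)
    then obtain c where c: "c \<in> C" "(\<Sum>k\<in>K. S f \<alpha> k * v i0 c k) \<le> 0"
      using sum_pos[OF \<open>finite C\<close> \<open>C \<noteq> {}\<close>, of "\<lambda>c. \<Sum>k\<in>K. S f \<alpha> k * v i0 c k"]
      by (metis less_irrefl not_less)
    define g where "g = f(i0 := c)"
    have "g \<in> \<Phi>" using f(1) c \<alpha> by (auto simp: g_def \<Phi>_def PiE_iff extensional_def)
    moreover have S: "S g \<alpha> = S f \<alpha>"
      unfolding S_def g_def using \<alpha> by (intro ext sum.cong) auto
    moreover have "Q g \<alpha> = q" using \<alpha> S by (simp add: Q_def)
    ultimately have "q \<le> (\<Sum>k\<in>K. S f \<alpha> k * v i0 c k)"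
      using vertex[of g \<alpha> i0] \<alpha> by (simp add: g_def)
    with c \<open>q > 0\<close> show False by simp
  qed
  then have "S f (a f) k = 0" if "k \<in> K" for k
    using that \<open>finite K\<close> by (simp add: q_def Q_def sum_nonneg_eq_0_iff)
  moreover have "f ` I \<subseteq> C" using f by (auto simp: \<Phi>_def)
  ultimately show ?thesis using a(1)[of f] unfolding S_def D_def by blast
qed

text \<open>Sarkaria's trick: colour \<open>c < r - 1\<close> stands for the unit vector \<open>e\<^sub>c\<close> of dimension \<open>r - 1\<close>, colour
  \<open>r - 1\<close> for \<open>- (e\<^sub>0 + \<dots> + e\<^sub>r\<^sub>-\<^sub>2)\<close>, and \<open>v i c\<close> is the tensor product of the point \<open>(x i, 1)\<close> with the vector
  of colour \<open>c\<close>.\<close>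

theorem tverberg_coordinates:
  fixes x :: "'i \<Rightarrow> 'b \<Rightarrow> real"
  assumes "finite B" "finite I" "r \<ge> 1" "(r - 1) * (card B + 1) < card I"
  shows "\<exists>f \<alpha> z. (\<forall>i\<in>I. f i < r \<and> 0 \<le> \<alpha> i) \<and>
           (\<forall>j<r. sum \<alpha> {i\<in>I. f i = j} = 1 \<and> (\<forall>b\<in>B. (\<Sum>i | i \<in> I \<and> f i = j. \<alpha> i * x i b) = z b))"
proof -
  define y where "y i b = (case b of None \<Rightarrow> 1 | Some b \<Rightarrow> x i b)" for i b
  define B' where "B' = insert None (Some ` B)"
  define K where "K = {..<r - 1} \<times> B'"
  define v where "v i c k = y i (snd k) * (if c = fst k then 1 else if c = r - 1 then - 1 else 0)"
    for i c and k :: "nat \<times> 'b option"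
  have "card B' = card B + 1"
    using assms(1) by (simp add: B'_def card_insert_if card_image)
  then have "card K < card I" using assms by (simp add: K_def card_cartesian_product)
  moreover have "finite K" using assms by (simp add: K_def B'_def)
  moreover have "(\<Sum>c<r. v i c k) = 0" if "k \<in> K" for i k
  proof -
    have "fst k < r - 1" using that by (auto simp: K_def)
    then have "(\<Sum>c<r. v i c k) = (\<Sum>c<r. (if c = fst k then y i (snd k) else 0) - (if c = r - 1 then y i (snd k) else 0))"
      by (intro sum.cong) (auto simp: v_def)
    also have "\<dots> = 0" using \<open>fst k < r - 1\<close> by (simp add: sum_subtractf)
    finally show ?thesis .
  qed
  ultimately obtain f \<alpha> where f: "f ` I \<subseteq> {..<r}" "\<And>i. i \<in> I \<Longrightarrow> 0 \<le> \<alpha> i" "sum \<alpha> I = 1"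
    and 0: "\<And>k. k \<in> K \<Longrightarrow> (\<Sum>i\<in>I. \<alpha> i * v i (f i) k) = 0"
    using colourful_caratheodory[of K I "{..<r}" v] assms by (metis finite_lessThan lessThan_empty_iff not_one_le_zero)
  define Z where "Z j b = (\<Sum>i | i \<in> I \<and> f i = j. \<alpha> i * y i b)" for j b
  \<comment> \<open>Coordinate \<open>(j, b)\<close> of the vanishing combination is the difference
    of the weighted sums over colour classes \<open>j\<close> and \<open>r - 1\<close>.\<close>
  have Z_eq: "Z j b = Z (r - 1) b" if "j < r" "b \<in> B'" for j b
  proof (cases "j = r - 1")
    case False
    with that have "(j, b) \<in> K" by (auto simp: K_def)
    from 0[OF this] have "0 = (\<Sum>i\<in>I. \<alpha> i * v i (f i) (j, b))" by simp
    also have "\<dots> = (\<Sum>i\<in>I. (if f i = j then \<alpha> i * y i b else 0) - (if f i = r - 1 then \<alpha> i * y i b else 0))"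
      using False by (intro sum.cong) (auto simp: v_def)
    also have "\<dots> = Z j b - Z (r - 1) b"
      using \<open>finite I\<close> by (simp add: sum_subtractf Z_def sum.inter_filter)
    finally show ?thesis by simp
  qed simp
  \<comment> \<open>The coordinate \<open>None\<close> is constantly 1, so \<open>Z_eq\<close> makes
    the classes equally heavy: each has weight 1 / r, and scaling by \<open>r\<close> normalizes
    them.\<close>
  have "1 = sum \<alpha> I" using f by simp
  also have "\<dots> = (\<Sum>j<r. sum \<alpha> {i\<in>I. f i = j})"
    using f \<open>finite I\<close> by (intro sum.group[symmetric]) auto
  also have "\<dots> = (\<Sum>j<r. Z (r - 1) None)"
  proof (rule sum.cong[OF refl])
    fix j assume "j \<in> {..<r}"
    then have "Z j None = Z (r - 1) None" by (intro Z_eq) (auto simp: B'_def)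
    then show "sum \<alpha> {i\<in>I. f i = j} = Z (r - 1) None" by (simp add: Z_def y_def)
  qed
  finally have Z1: "real r * Z (r - 1) None = 1" by simp
  show ?thesis
  proof (intro exI conjI ballI allI impI)
    fix i assume "i \<in> I"
    then show "f i < r" "0 \<le> real r * \<alpha> i" using f by auto
  next
    fix j assume "j < r"
    have "(\<Sum>i | i \<in> I \<and> f i = j. real r * \<alpha> i) = real r * Z j None"
      by (simp add: Z_def y_def sum_distrib_left)
    then show "(\<Sum>i | i \<in> I \<and> f i = j. real r * \<alpha> i) = 1"
      using Z_eq[OF \<open>j < r\<close>, of None] Z1 by (simp add: B'_def)
  next
    fix j b assume "j < r" "b \<in> B"
    have "(\<Sum>i | i \<in> I \<and> f i = j. real r * \<alpha> i * x i b) = real r * Z j (Some b)"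
      by (simp add: Z_def y_def sum_distrib_left algebra_simps)
    then show "(\<Sum>i | i \<in> I \<and> f i = j. real r * \<alpha> i * x i b) = real r * Z (r - 1) (Some b)"
      using Z_eq[OF \<open>j < r\<close>, of "Some b"] \<open>b \<in> B\<close> by (simp add: B'_def)
  qed
qed

section \<open>Positive semidefinite matrices\<close>

definition diagonal_matrix :: "('n \<Rightarrow> real) \<Rightarrow> real^'n^'n" where
  "diagonal_matrix l = (\<chi> i j. if i = j then l i else 0)"

definition positive_semidefinite :: "real^'n^'n \<Rightarrow> bool" where
  "positive_semidefinite A \<longleftrightarrow> transpose A = A \<and> (\<forall>x. 0 \<le> x \<bullet> (A *v x))"

lemma transpose_diagonal_matrix [simp]: "transpose (diagonal_matrix l) = diagonal_matrix l"
  by (auto simp: diagonal_matrix_def transpose_def vec_eq_iff)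

lemma det_diagonal_matrix: "det (diagonal_matrix l) = prod l UNIV"
  by (subst det_diagonal) (auto simp: diagonal_matrix_def)

lemma trace_diagonal_matrix: "trace (diagonal_matrix l) = sum l UNIV"
  by (simp add: trace_def diagonal_matrix_def)

lemma diagonal_matrix_mult_vec: "(diagonal_matrix l *v x) $ i = l i * x $ i"
  by (simp add: diagonal_matrix_def matrix_vector_mult_def if_distrib[of "\<lambda>u. u * _"] cong: if_cong)

lemma diagonal_matrix_mult: "diagonal_matrix l ** diagonal_matrix m = diagonal_matrix (\<lambda>i. l i * m i)"
  by (simp add: matrix_eq matrix_vector_mul_assoc[symmetric] vec_eq_iff diagonal_matrix_mult_vec)

section \<open>Spectral theorem for real symmetric matrices\<close>

lemma inner_transpose_matrix_vector:
  fixes A :: "real^'n^'m"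
  shows "(transpose A *v x) \<bullet> y = x \<bullet> (A *v y)"
  by (simp add: dot_lmul_matrix)

text \<open>A maximizer v of the quadratic form on the unit sphere of \<open>V\<close> has residual
  w = A v - l v equal to 0, since moving from v along w raises the form, relative to l times the
  squared norm, by twice the squared norm of w to first order. The invariant subspace
  \<open>V\<close> lets the diagonalization continue in the orthogonal complement of the
  eigenvectors found so far.\<close>

lemma symmetric_matrix_eigenvector:
  fixes A :: "real^'n^'n"
  assumes sym: "transpose A = A" and V: "subspace V" "\<And>x. x \<in> V \<Longrightarrow> A *v x \<in> V" "\<exists>x\<in>V. x \<noteq> 0"
  obtains v l where "v \<in> V" "norm v = 1" "A *v v = l *\<^sub>R v"
proof -
  let ?T = "V \<inter> sphere 0 1"
  from V(3) obtain x where x: "x \<in> V" "x \<noteq> 0" by auto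
  then have "x /\<^sub>R norm x \<in> ?T" using V(1) by (auto simp: subspace_scale)
  moreover have "compact ?T"
    using V(1) by (simp add: closed_Int_compact closed_subspace)
  moreover have "continuous_on ?T (\<lambda>x. x \<bullet> (A *v x))"
    by (intro continuous_intros)
  ultimately obtain v where v: "v \<in> ?T" "\<And>x. x \<in> ?T \<Longrightarrow> x \<bullet> (A *v x) \<le> v \<bullet> (A *v v)"
    using continuous_attains_sup[of ?T "\<lambda>x. x \<bullet> (A *v x)"] by blast
  define l where "l = v \<bullet> (A *v v)"
  have vv: "v \<bullet> v = 1" using v(1) by (simp add: norm_eq_1)
  have le: "x \<bullet> (A *v x) \<le> l * (x \<bullet> x)" if "x \<in> V" for x
  proof (cases "x = 0")
    case False
    define c where "c = norm x"
    have "c > 0" using False by (simp add: c_def)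
    have "x /\<^sub>R c \<in> ?T" using V(1) that False by (auto simp: subspace_scale c_def)
    from v(2)[OF this] have "(x \<bullet> (A *v x)) / c\<^sup>2 \<le> l"
      by (simp add: l_def matrix_vector_mult_scaleR power2_eq_square divide_simps)
    then show ?thesis
      using \<open>c > 0\<close> by (simp add: field_simps c_def power2_norm_eq_inner)
  qed simp
  define w where "w = A *v v - l *\<^sub>R v"
  have wV: "w \<in> V" using v(1) V by (auto simp: w_def subspace_diff subspace_scale)
  have Aw: "v \<bullet> (A *v w) = w \<bullet> (A *v v)"
    using inner_transpose_matrix_vector[of A v w] sym by (simp add: inner_commute)
  have ww: "w \<bullet> (A *v v) = w \<bullet> w + l * (w \<bullet> v)"
    by (simp add: w_def inner_simps)
  have "0 \<le> - 2 * (w \<bullet> w) + t * (l * (w \<bullet> w) - w \<bullet> (A *v w))" if "0 < t" "t \<le> 1" for t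
  proof -
    have "v + t *\<^sub>R w \<in> V" using v(1) wV V(1) by (auto simp: subspace_add subspace_scale)
    from le[OF this] have "0 \<le> t * (- 2 * (w \<bullet> w) + t * (l * (w \<bullet> w) - w \<bullet> (A *v w)))"
      using vv ww by (simp add: matrix_vector_right_distrib matrix_vector_mult_scaleR
          inner_simps Aw l_def[symmetric] inner_commute[of v w] algebra_simps)
    with \<open>0 < t\<close> show ?thesis by (simp add: zero_le_mult_iff)
  qed
  then have "0 \<le> - 2 * (w \<bullet> w)" by (rule nonneg_if_nonneg_perturbations)
  then have "w = 0" using inner_ge_zero[of w] by (simp add: antisym)
  then show thesis using that[of v l] v(1) by (auto simp: w_def)
qed

theorem symmetric_matrix_diagonalization:
  fixes A :: "real^'n^'n"
  assumes sym: "transpose A = A"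
  obtains P l where "orthogonal_matrix P" "A = P ** diagonal_matrix l ** transpose P"
proof -
  have "\<exists>S. finite S \<and> card S = k \<and> pairwise orthogonal S \<and> (\<forall>x\<in>S. norm x = 1 \<and> (\<exists>l. A *v x = l *\<^sub>R x))"
    if "k \<le> CARD('n)" for k
    using that
  proof (induction k)
    case 0
    show ?case by (intro exI[of _ "{}"]) auto
  next
    case (Suc k)
    then obtain S where S: "finite S" "card S = k" "pairwise orthogonal S"
      "\<And>x. x \<in> S \<Longrightarrow> norm x = 1 \<and> (\<exists>l. A *v x = l *\<^sub>R x)" by auto
    define V where "V = {x. \<forall>s\<in>S. orthogonal s x}"
    have "subspace V"
      unfolding V_def subspace_def by (auto simp: orthogonal_clauses)
    moreover have "A *v x \<in> V" if "x \<in> V" for x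
      unfolding V_def
    proof clarify
      fix s assume "s \<in> S"
      then obtain l where "A *v s = l *\<^sub>R s" using S(4) by blast
      then have "s \<bullet> (A *v x) = l * (s \<bullet> x)"
        using inner_transpose_matrix_vector[of A s x] sym by simp
      then show "orthogonal s (A *v x)"
        using that \<open>s \<in> S\<close> by (auto simp: V_def orthogonal_def)
    qed
    moreover have "\<exists>x\<in>V. x \<noteq> 0"
    proof -
      have "dim S < DIM(real^'n)"
        using dim_le_card'[OF S(1)] S(2) Suc.prems by simp
      then obtain x where "x \<noteq> 0" "\<And>y. y \<in> span S \<Longrightarrow> orthogonal x y"
        using orthogonal_to_subspace_exists by metis
      then show ?thesis
        by (intro bexI[of _ x]) (auto simp: V_def orthogonal_commute span_base)
    qed
    ultimately obtain v l where v: "v \<in> V" "norm v = 1" "A *v v = l *\<^sub>R v"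
      using symmetric_matrix_eigenvector[OF sym] by metis
    have "v \<notin> S" using v by (auto simp: V_def orthogonal_self)
    show ?case
    proof (intro exI[of _ "insert v S"] conjI)
      show "pairwise orthogonal (insert v S)"
        using S(3) v(1) by (auto simp: pairwise_insert V_def orthogonal_commute)
    qed (use S v \<open>v \<notin> S\<close> in auto)
  qed
  from this[of "CARD('n)"] obtain S where S: "finite S" "card S = CARD('n)" "pairwise orthogonal S"
      "\<And>x. x \<in> S \<Longrightarrow> norm x = 1 \<and> (\<exists>l. A *v x = l *\<^sub>R x)" by auto
  then obtain f where f: "bij_betw f (UNIV :: 'n set) S"
    by (metis finite_class.finite_UNIV finite_same_card_bij)
  then have fS: "f j \<in> S" for j by (auto simp: bij_betw_def)
  then have "\<forall>j. \<exists>l. A *v f j = l *\<^sub>R f j" using S(4) by blast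
  then obtain l where l: "\<And>j. A *v f j = l j *\<^sub>R f j" by metis
  define P where "P = (\<chi> i j. f j $ i)"
  have "column j P = f j" for j by (simp add: column_def P_def vec_eq_iff)
  moreover have "orthogonal (f i) (f j)" if "i \<noteq> j" for i j
    using S(3) f fS that by (metis pairwise_def bij_betw_def injD)
  ultimately have P: "orthogonal_matrix P"
    using S(4) fS by (simp add: orthogonal_matrix_orthonormal_columns)
  have "(A ** P) $ i $ j = (P ** diagonal_matrix l) $ i $ j" for i j
  proof -
    have "(A ** P) $ i $ j = (A *v f j) $ i"
      by (simp add: matrix_matrix_mult_def matrix_vector_mult_def P_def)
    also have "\<dots> = (P ** diagonal_matrix l) $ i $ j"
      by (simp add: l matrix_matrix_mult_def diagonal_matrix_def P_def if_distrib[of "\<lambda>u. _ * u"] cong: if_cong)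
    finally show ?thesis .
  qed
  then have "A ** P = P ** diagonal_matrix l" by (simp add: vec_eq_iff)
  then have "A ** P ** transpose P = P ** diagonal_matrix l ** transpose P" by simp
  then have "A = P ** diagonal_matrix l ** transpose P"
    using P by (simp add: matrix_mul_assoc[symmetric] orthogonal_matrix_def)
  with P that show thesis by blast
qed

lemma positive_semidefinite_diagonalization:
  assumes "positive_semidefinite A"
  obtains P l where "orthogonal_matrix P" "A = P ** diagonal_matrix l ** transpose P" "\<And>i. 0 \<le> l i"
proof -
  obtain P l where P: "orthogonal_matrix P" "A = P ** diagonal_matrix l ** transpose P"
    using assms symmetric_matrix_diagonalization unfolding positive_semidefinite_def by metis
  have "0 \<le> l i" for i
  proof -
    define v where "v = P *v axis i 1"
    have "transpose P *v v = axis i 1"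
      using P(1) by (simp add: v_def matrix_vector_mul_assoc orthogonal_matrix)
    then have "v \<bullet> (A *v v) = axis i 1 \<bullet> (diagonal_matrix l *v axis i 1)"
      using inner_transpose_matrix_vector[of P v "diagonal_matrix l *v axis i 1"]
      by (simp add: P(2) matrix_vector_mul_assoc[symmetric])
    also have "\<dots> = l i" by (simp add: inner_axis' diagonal_matrix_mult_vec)
    finally show ?thesis using assms by (metis positive_semidefinite_def)
  qed
  with P that show thesis by blast
qed

lemma positive_semidefinite_factorization:
  fixes A :: "real^'n^'n"
  assumes "positive_semidefinite A"
  obtains L :: "real^'n^'n" where "A = L ** transpose L"
proof -
  obtain P l where "orthogonal_matrix P" and P: "A = P ** diagonal_matrix l ** transpose P" "\<And>i. 0 \<le> l i"
    using positive_semidefinite_diagonalization[OF assms] by blast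
  define L where "L = P ** diagonal_matrix (\<lambda>i. sqrt (l i))"
  have "L ** transpose L = P ** (diagonal_matrix (\<lambda>i. sqrt (l i)) ** diagonal_matrix (\<lambda>i. sqrt (l i))) ** transpose P"
    by (simp add: L_def matrix_transpose_mul matrix_mul_assoc)
  also have "\<dots> = A" using P by (simp add: diagonal_matrix_mult)
  finally show thesis using that by metis
qed

text \<open>The second claim is the inequality of arithmetic and geometric means for the
  eigenvalues.\<close>

lemma positive_semidefinite_det:
  fixes A :: "real^'n^'n"
  assumes "positive_semidefinite A"
  shows "0 \<le> det A" and "trace A \<le> CARD('n) \<Longrightarrow> det A \<le> 1"
proof -
  obtain P l where P: "orthogonal_matrix P" "A = P ** diagonal_matrix l ** transpose P" "\<And>i. 0 \<le> l i"
    using positive_semidefinite_diagonalization[OF assms] by metis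
  have "det P * det P = 1"
    using P(1) det_orthogonal_matrix by fastforce
  then have det: "det A = prod l UNIV"
    by (simp add: P(2) det_mul det_diagonal_matrix)
  then show "0 \<le> det A" using P(3) by (simp add: prod_nonneg)
  assume "trace A \<le> CARD('n)"
  moreover have "trace A = trace (transpose P ** (P ** diagonal_matrix l))"
    unfolding P(2) by (rule trace_mul_sym)
  then have "trace A = sum l UNIV"
    using P(1) by (simp add: matrix_mul_assoc orthogonal_matrix trace_diagonal_matrix)
  ultimately have "(\<Sum>i\<in>UNIV. l i / CARD('n)) \<le> 1"
    by (simp add: sum_divide_distrib[symmetric])
  then have le: "prod l UNIV powr (1 / CARD('n)) \<le> 1"
    using arith_geom_mean[of "UNIV :: 'n set" l] P(3) by simp
  show "det A \<le> 1"
  proof (rule ccontr)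
    assume "\<not> det A \<le> 1"
    then have "1 < prod l UNIV powr (1 / CARD('n))"
      by (simp add: det gr_one_powr)
    with le show False by simp
  qed
qed

lemma positive_semidefinite_congruence:
  assumes "positive_semidefinite A"
  shows "positive_semidefinite (M ** A ** transpose M)"
  unfolding positive_semidefinite_def
proof safe
  show "transpose (M ** A ** transpose M) = M ** A ** transpose M"
    using assms by (simp add: positive_semidefinite_def matrix_transpose_mul matrix_mul_assoc)
  fix x
  have "x \<bullet> ((M ** A ** transpose M) *v x) = (transpose M *v x) \<bullet> (A *v (transpose M *v x))"
    by (metis inner_transpose_matrix_vector matrix_vector_mul_assoc)
  then show "0 \<le> x \<bullet> ((M ** A ** transpose M) *v x)"
    using assms by (simp add: positive_semidefinite_def)
qed

section \<open>Determinants of convex combinations\<close>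

lemma positive_semidefinite_quadratic_form_eq_0:
  fixes A :: "real^'n^'n"
  assumes "positive_semidefinite A" "det A \<noteq> 0" "x \<bullet> (A *v x) = 0"
  shows "x = 0"
proof -
  obtain L :: "real^'n^'n" where L: "A = L ** transpose L"
    using positive_semidefinite_factorization[OF assms(1)] by metis
  have "(transpose L *v x) \<bullet> (transpose L *v x) = 0"
    using assms(3) by (metis inner_transpose_matrix_vector L matrix_vector_mul_assoc)
  then have "A *v x = 0" by (metis L inner_eq_zero_iff matrix_vector_mul_assoc matrix_vector_mult_0_right)
  moreover have "invertible A" using assms(2) by (simp add: invertible_det_nz)
  ultimately show ?thesis by (metis matrix_left_invertible_ker invertible_def)
qed

lemma matrix_vector_mult_sum_left:
  fixes A :: "'j \<Rightarrow> real^'n^'m"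
  shows "(\<Sum>j\<in>J. \<alpha> j *\<^sub>R A j) *v x = (\<Sum>j\<in>J. \<alpha> j *\<^sub>R (A j *v x))"
  by (induction J rule: infinite_finite_induct)
    (auto simp: matrix_vector_mult_add_rdistrib scaleR_matrix_vector_assoc)

text \<open>A congruence turns the convex combination into the identity matrix; then some summand has trace at
  most \<open>CARD('n)\<close>, hence determinant at most one.\<close>

theorem det_convex_combination_ge:
  fixes A :: "'j \<Rightarrow> real^'n^'n"
  assumes "finite J" "\<And>j. j \<in> J \<Longrightarrow> 0 \<le> \<alpha> j" "sum \<alpha> J = 1" "0 < \<kappa>"
    and A: "\<And>j. j \<in> J \<Longrightarrow> positive_semidefinite (A j)" "\<And>j. j \<in> J \<Longrightarrow> \<kappa> \<le> det (A j)"
  shows "\<kappa> \<le> det (\<Sum>j\<in>J. \<alpha> j *\<^sub>R A j)"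
proof -
  define S where "S = (\<Sum>j\<in>J. \<alpha> j *\<^sub>R A j)"
  have quad: "x \<bullet> (S *v x) = (\<Sum>j\<in>J. \<alpha> j * (x \<bullet> (A j *v x)))" for x
    by (simp add: S_def matrix_vector_mult_sum_left inner_sum_right)
  have nonneg: "0 \<le> \<alpha> j * (x \<bullet> (A j *v x))" if "j \<in> J" for j x
    using A(1)[OF that] assms(2)[OF that] by (simp add: positive_semidefinite_def)
  have "A j $ k $ i = A j $ i $ k" if "j \<in> J" for j i k
  proof -
    have "transpose (A j) $ i $ k = A j $ i $ k"
      using A(1)[OF that] by (simp add: positive_semidefinite_def)
    then show ?thesis by (simp add: transpose_def)
  qed
  then have "transpose S = S"
    by (simp add: S_def vec_eq_iff transpose_def)
  then have S: "positive_semidefinite S"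
    by (simp add: positive_semidefinite_def quad sum_nonneg nonneg)
  then obtain L :: "real^'n^'n" where L: "S = L ** transpose L"
    using positive_semidefinite_factorization by metis
  \<comment> \<open>A kernel vector of \<open>S\<close> makes every weighted form vanish; some
    weight is nonzero, and the corresponding \<open>A j\<close> is definite because its determinant
    is at least \<open>\<kappa>\<close>.\<close>
  have "S *v x = 0 \<longrightarrow> x = 0" for x
  proof
    assume "S *v x = 0"
    then have "(\<Sum>j\<in>J. \<alpha> j * (x \<bullet> (A j *v x))) = 0" using quad[of x] by simp
    then have 0: "\<alpha> j * (x \<bullet> (A j *v x)) = 0" if "j \<in> J" for j
      using nonneg sum_nonneg_eq_0_iff[OF \<open>finite J\<close>, of "\<lambda>j. \<alpha> j * (x \<bullet> (A j *v x))"] that by auto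
    obtain j where "j \<in> J" "\<alpha> j \<noteq> 0" using assms(3) by (metis sum.neutral zero_neq_one)
    with 0[of j] A[of j] \<open>0 < \<kappa>\<close> show "x = 0"
      by (intro positive_semidefinite_quadratic_form_eq_0[of "A j"]) auto
  qed
  then have "invertible S"
    by (metis matrix_left_invertible_ker invertible_left_inverse)
  then have "det L \<noteq> 0" by (auto simp: L invertible_det_nz det_mul)
  then obtain M where M: "M ** L = mat 1"
    by (metis invertible_det_nz invertible_def)
  have detM: "det M * det L = 1" using M by (metis det_I det_mul)
  define C where "C j = M ** A j ** transpose M" for j
  have "(\<Sum>j\<in>J. \<alpha> j *\<^sub>R C j) = M ** S ** transpose M"
    unfolding matrix_eq
    by (auto simp: matrix_vector_mult_sum_left C_def S_def matrix_vector_mul_assoc[symmetric]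
        matrix_vector_mult_scaleR matrix_vector_right_distrib linear_sum[OF matrix_vector_mul_linear])
  also have "\<dots> = (M ** L) ** transpose (M ** L)"
    by (simp add: L matrix_transpose_mul matrix_mul_assoc)
  finally have "trace (\<Sum>j\<in>J. \<alpha> j *\<^sub>R C j) = CARD('n)" by (simp add: M trace_I)
  moreover have "trace (\<Sum>j\<in>J. \<alpha> j *\<^sub>R C j) = (\<Sum>j\<in>J. \<alpha> j * trace (C j))"
    by (simp add: trace_def sum_distrib_left sum.swap[of _ J])
  ultimately have tr: "(\<Sum>j\<in>J. \<alpha> j * (trace (C j) - CARD('n))) = 0"
    by (simp add: right_diff_distrib sum_subtractf sum_distrib_right[symmetric] assms(3))
  have "\<exists>j\<in>J. trace (C j) \<le> CARD('n)"
  proof (rule ccontr)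
    assume "\<not> ?thesis"
    then have gt: "trace (C j) - CARD('n) > 0" if "j \<in> J" for j using that by auto
    then have "\<alpha> j * (trace (C j) - CARD('n)) = 0" if "j \<in> J" for j
      using tr sum_nonneg_eq_0_iff[OF \<open>finite J\<close>, of "\<lambda>j. \<alpha> j * (trace (C j) - CARD('n))"] assms(2) that
      by (auto simp: less_imp_le)
    then have "\<alpha> j = 0" if "j \<in> J" for j using gt[OF that] that by fastforce
    then show False using assms(3) by simp
  qed
  then obtain j where j: "j \<in> J" "trace (C j) \<le> CARD('n)" by auto
  \<comment> \<open>Undoing the congruence: \<open>det S\<close> is the square of
    \<open>det L\<close>, and \<open>det M\<close> is the inverse of \<open>det L\<close>, so this
    says that \<open>det (A j)\<close> is at most \<open>det S\<close>.\<close>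
  have "det (C j) \<le> 1"
    using j A(1) unfolding C_def by (intro positive_semidefinite_det positive_semidefinite_congruence)
  then have "det M * det M * det (A j) \<le> 1" by (simp add: C_def det_mul algebra_simps)
  then have "(det L)\<^sup>2 * (det M * det M * det (A j)) \<le> (det L)\<^sup>2"
    using mult_left_mono[of _ 1 "(det L)\<^sup>2"] by simp
  moreover have "(det L)\<^sup>2 * (det M * det M * det (A j)) = (det M * det L)\<^sup>2 * det (A j)"
    by (simp add: power2_eq_square)
  ultimately have "det (A j) \<le> (det L)\<^sup>2" using detM by simp
  also have "\<dots> = det S" by (simp add: L det_mul power2_eq_square)
  finally show ?thesis using A(2)[OF j(1)] by (simp add: S_def)
qed

section \<open>Reflections and matrices of maximal trace\<close>

definition outer_product :: "real^'n \<Rightarrow> real^'n \<Rightarrow> real^'n^'n" where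
  "outer_product u v = (\<chi> i j. u $ i * v $ j)"

lemma outer_product_mult_vec: "outer_product u v *v x = (v \<bullet> x) *\<^sub>R u"
  by (simp add: outer_product_def matrix_vector_mult_def vec_eq_iff inner_vec_def sum_distrib_left
      sum_distrib_right algebra_simps)

lemma trace_mult_outer_product: "trace (A ** outer_product u v) = v \<bullet> (A *v u)"
  by (simp add: trace_def matrix_matrix_mult_def outer_product_def inner_vec_def matrix_vector_mult_def
      sum_distrib_left algebra_simps)

definition householder :: "real^'n \<Rightarrow> real^'n^'n" where
  "householder v = mat 1 - 2 *\<^sub>R outer_product v v"

lemma householder_mult_vec: "householder v *v x = x - (2 * (v \<bullet> x)) *\<^sub>R v"
  by (simp add: householder_def matrix_vector_mult_diff_rdistrib scaleR_matrix_vector_assoc[symmetric]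
      outer_product_mult_vec)

lemma orthogonal_householder:
  assumes "norm v = 1"
  shows "orthogonal_matrix (householder v)"
proof -
  have "v \<bullet> v = 1" using assms by (simp add: norm_eq_1)
  then have "orthogonal_transformation ((*v) (householder v))"
    unfolding orthogonal_transformation_def householder_mult_vec[abs_def]
    by (auto simp: inner_simps inner_commute algebra_simps intro!: linearI)
  then show ?thesis by (simp add: orthogonal_transformation_matrix)
qed

lemma trace_mult_householder: "trace (A ** householder v) = trace A - 2 * (v \<bullet> (A *v v))"
proof -
  have "A ** householder v = A - 2 *\<^sub>R (A ** outer_product v v)"
    by (simp add: matrix_eq matrix_vector_mul_assoc[symmetric] householder_mult_vec outer_product_mult_vec
        matrix_vector_mult_diff_rdistrib matrix_vector_mult_diff_distrib matrix_vector_mult_scaleR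
        scaleR_matrix_vector_assoc[symmetric])
  then show ?thesis
    by (simp add: trace_sub trace_mult_outer_product[symmetric]) (simp add: trace_def sum_distrib_left)
qed

text \<open>A single reflection yields nonnegativity of the quadratic form; the product of two reflections in
  nearby hyperplanes, an infinitesimal rotation, yields symmetry.\<close>

theorem trace_maximal_imp_positive_semidefinite:
  fixes A :: "real^'n^'n"
  assumes max: "\<And>Q. orthogonal_matrix Q \<Longrightarrow> trace (A ** Q) \<le> trace A"
  shows "positive_semidefinite A"
proof -
  define q where "q x y = x \<bullet> (A *v y)" for x y
  have unit: "2 * (u \<bullet> v) * q v u \<le> q u u + q v v" if "norm u = 1" "norm v = 1" for u v
  proof -
    have "trace (A ** (householder u ** householder v)) \<le> trace A"
      using that by (intro max orthogonal_matrix_mul orthogonal_householder)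
    moreover have "trace (A ** (householder u ** householder v)) =
        trace A - 2 * q u u - 2 * (q v v - 2 * (u \<bullet> v) * q v u)"
      by (simp add: matrix_mul_assoc trace_mult_householder q_def matrix_vector_mul_assoc[symmetric]
          householder_mult_vec matrix_vector_mult_diff_distrib matrix_vector_mult_scaleR inner_simps)
    ultimately show ?thesis by simp
  qed
  have scale: "q (a *\<^sub>R x) (b *\<^sub>R y) = a * b * q x y" for a b x y
    by (simp add: q_def matrix_vector_mult_scaleR)
  \<comment> \<open>Removing the normalization of \<open>v\<close> allows
    \<open>v = u + t *\<^sub>R w\<close> to be inserted directly.\<close>
  have homogeneous: "2 * (u \<bullet> v) * q v u \<le> q u u * (v \<bullet> v) + q v v" if "norm u = 1" "v \<noteq> 0" for u v
  proof -
    define c where "c = norm v"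
    have "c > 0" using that by (simp add: c_def)
    have "2 * (u \<bullet> (v /\<^sub>R c)) * q (v /\<^sub>R c) u \<le> q u u + q (v /\<^sub>R c) (v /\<^sub>R c)"
      using that by (intro unit) (auto simp: c_def)
    then have "2 * (u \<bullet> v) * q v u / c\<^sup>2 \<le> q u u + q v v / c\<^sup>2"
      using scale[of "inverse c" v 1 u]
      by (simp add: scale power2_eq_square divide_inverse mult.assoc mult.left_commute mult.commute)
    then have "2 * (u \<bullet> v) * q v u \<le> q u u * c\<^sup>2 + q v v"
      using \<open>c > 0\<close> by (simp add: field_simps)
    then show ?thesis by (simp add: c_def power2_norm_eq_inner)
  qed
  \<comment> \<open>Insert \<open>v = u + t *\<^sub>R w\<close> with w orthogonal to u: the constant
    terms cancel and the terms linear in t give the claim. Exchanging u and w gives the reverse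
    inequality, hence symmetry.\<close>
  have le: "q w u \<le> q u w" if "norm u = 1" "norm w = 1" "u \<bullet> w = 0" for u w
  proof -
    have "0 \<le> (q u w - q w u) + t * (q u u + q w w)" if t: "0 < t" "t \<le> 1" for t
    proof -
      have uu: "u \<bullet> u = 1" "w \<bullet> w = 1" using \<open>norm u = 1\<close> \<open>norm w = 1\<close> by (auto simp: norm_eq_1)
      have "u + t *\<^sub>R w \<noteq> 0"
      proof
        assume "u + t *\<^sub>R w = 0"
        then have "u \<bullet> (u + t *\<^sub>R w) = 0" by simp
        then show False using uu \<open>u \<bullet> w = 0\<close> by (simp add: inner_simps)
      qed
      then have "2 * (u \<bullet> (u + t *\<^sub>R w)) * q (u + t *\<^sub>R w) u
          \<le> q u u * ((u + t *\<^sub>R w) \<bullet> (u + t *\<^sub>R w)) + q (u + t *\<^sub>R w) (u + t *\<^sub>R w)"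
        by (intro homogeneous \<open>norm u = 1\<close>)
      then have "0 \<le> t * ((q u w - q w u) + t * (q u u + q w w))"
        using uu \<open>u \<bullet> w = 0\<close>
        by (simp add: q_def inner_simps matrix_vector_right_distrib matrix_vector_mult_scaleR
            inner_commute[of w u] algebra_simps)
      with t show ?thesis by (simp add: zero_le_mult_iff)
    qed
    then have "0 \<le> q u w - q w u" by (rule nonneg_if_nonneg_perturbations)
    then show ?thesis by simp
  qed
  have entry: "q (axis i 1) (axis j 1) = A $ i $ j" for i j
    by (simp add: q_def inner_axis' matrix_vector_mult_basis column_def)
  have "A $ j $ i = A $ i $ j" for i j
  proof (cases "i = j")
    case False
    then have "axis i (1::real) \<bullet> axis j 1 = 0" by (simp add: inner_axis_axis)
    then show ?thesis
      using le[of "axis i 1" "axis j 1"] le[of "axis j 1" "axis i 1"]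
      by (simp add: entry norm_axis_1 inner_commute)
  qed simp
  then have "transpose A = A" by (simp add: transpose_def vec_eq_iff)
  moreover have "0 \<le> x \<bullet> (A *v x)" for x
  proof (cases "x = 0")
    case False
    define u where "u = x /\<^sub>R norm x"
    have u: "norm u = 1" "x = norm x *\<^sub>R u" using False by (auto simp: u_def)
    then have "0 \<le> q u u"
      using max[OF orthogonal_householder[OF u(1)]] by (simp add: trace_mult_householder q_def)
    moreover have "q x x = norm x * norm x * q u u" using u(2) scale by metis
    ultimately show ?thesis by (simp add: q_def)
  qed simp
  ultimately show ?thesis by (simp add: positive_semidefinite_def)
qed

section \<open>Volume of affine images\<close>

lemma measure_swap_coordinates_cbox:
  fixes a b :: "real^'n"
  shows "measure lebesgue ((\<lambda>x. \<chi> i. x $ Transposition.transpose m n i) ` cbox a b) = measure lebesgue (cbox a b)"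
proof -
  let ?\<tau> = "Transposition.transpose m n" and ?h = "\<lambda>x::real^'n. \<chi> i. x $ Transposition.transpose m n i"
  have image: "?h ` cbox a b = cbox (?h a) (?h b)"
  proof (intro equalityI subsetI)
    fix y assume y: "y \<in> cbox (?h a) (?h b)"
    have "a $ i \<le> y $ ?\<tau> i \<and> y $ ?\<tau> i \<le> b $ i" for i
      using y by (simp add: mem_box_cart) (metis transpose_involutory)
    then have "?h y \<in> cbox a b" by (simp add: mem_box_cart)
    moreover have "y = ?h (?h y)" by (simp add: vec_eq_iff)
    ultimately show "y \<in> ?h ` cbox a b" by blast
  qed (auto simp: mem_box_cart)
  have "(\<Prod>i\<in>UNIV. b $ ?\<tau> i - a $ ?\<tau> i) = (\<Prod>i\<in>UNIV. b $ i - a $ i)"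
    by (rule prod.reindex_bij_betw[of ?\<tau> UNIV UNIV "\<lambda>i. b $ i - a $ i"]) simp
  moreover have "cbox (?h a) (?h b) = {} \<longleftrightarrow> cbox a b = {}"
    unfolding image[symmetric] by simp
  ultimately show ?thesis
    unfolding image by (simp add: content_cbox_if_cart)
qed

lemma measure_shear_cbox:
  fixes a b :: "real^'n"
  assumes "m \<noteq> n"
  shows "measure lebesgue ((\<lambda>x. \<chi> i. if i = m then x $ m + x $ n else x $ i) ` cbox a b) = measure lebesgue (cbox a b)"
    (is "measure lebesgue (?h ` _) = _")
proof (cases "cbox a b = {}")
  case False
  \<comment> \<open>Translating by \<open>v\<close> moves the lower \<open>n\<close>-th coordinate
    of the box to 0, which meets the sign condition of
    \<open>measure_shear_interval\<close>.\<close>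
  define v where "v = axis n (- a $ n)"
  have h: "?h (v + x) = ?h v + ?h x" for x by (simp add: vec_eq_iff)
  have "measure lebesgue (?h ` cbox a b) = measure lebesgue ((+) (?h v) ` ?h ` cbox a b)"
    by (rule measure_translation[symmetric])
  also have "(+) (?h v) ` ?h ` cbox a b = ?h ` (+) v ` cbox a b"
    unfolding image_image h ..
  also have "(+) v ` cbox a b = cbox (v + a) (v + b)" by (simp add: cbox_translation)
  also have "measure lebesgue (?h ` cbox (v + a) (v + b)) = measure lebesgue (cbox (v + a) (v + b))"
    using False assms by (intro measure_shear_interval) (simp_all add: v_def cbox_translation)
  also have "\<dots> = measure lebesgue (cbox a b)"
    unfolding cbox_translation by (rule measure_translation)
  finally show ?thesis .
qed simp

text \<open>The fact \<open>measure_linear_image\<close> requires the index type to be of class \<open>wellorder\<close>.\<close>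

proposition
  fixes f :: "real^'n \<Rightarrow> real^'n"
  assumes "linear f" "S \<in> lmeasurable"
  shows lmeasurable_linear_image_cart: "f ` S \<in> lmeasurable"
    and measure_linear_image_cart: "measure lebesgue (f ` S) = \<bar>det (matrix f)\<bar> * measure lebesgue S"
proof -
  define Q where "Q f \<longleftrightarrow> (\<forall>S\<in>lmeasurable. f ` S \<in> lmeasurable \<and>
    measure lebesgue (f ` S) = \<bar>det (matrix f)\<bar> * measure lebesgue S)" for f :: "real^'n \<Rightarrow> real^'n"
  \<comment> \<open>For a linear map of determinant 1 or -1 it is enough to test boxes. This covers
    the coordinate swaps and the shears among the elementary maps of the induction.\<close>
  have unimodular: "Q h" if "linear h" "\<bar>det (matrix h)\<bar> = 1"
      "\<And>a b. measure lebesgue (h ` cbox a b) = measure lebesgue (cbox a b)" for h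
    unfolding Q_def
  proof
    fix S :: "(real^'n) set"
    assume "S \<in> lmeasurable"
    from measure_linear_sufficient[OF that(1) this, of 1] that(3)
    show "h ` S \<in> lmeasurable \<and> measure lebesgue (h ` S) = \<bar>det (matrix h)\<bar> * measure lebesgue S"
      by (simp add: that(2))
  qed
  have "Q f"
  proof (rule induct_linear_elementary[OF assms(1)])
    show "Q (f \<circ> g)" if "linear f" "linear g" "Q f" "Q g" for f g
      using that unfolding Q_def image_comp[symmetric]
      by (simp add: matrix_compose det_mul abs_mult)
  next
    fix f :: "real^'n \<Rightarrow> real^'n" and i
    assume f: "linear f" "\<And>x. f x $ i = 0"
    then have "axis i 1 \<notin> range f" by (metis axis_nth rangeE zero_neq_one)
    then have "\<not> inj f" using linear_injective_imp_surjective[OF f(1)] by blast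
    then have "negligible (f ` S)" "det (matrix f) = 0" for S
      using f(1) negligible_linear_singular_image det_nz_iff_inj by blast+
    then show "Q f" by (simp add: Q_def negligible_imp_measurable negligible_imp_measure0)
  next
    fix c :: "'n \<Rightarrow> real"
    have "det (matrix (\<lambda>x. \<chi> i. c i * x $ i)) = prod c UNIV"
      by (subst det_diagonal) (auto simp: matrix_def axis_def)
    then show "Q (\<lambda>x. \<chi> i. c i * x $ i)"
      by (simp add: Q_def measurable_stretch measure_stretch)
  next
    fix m n :: 'n
    let ?h = "\<lambda>x::real^'n. \<chi> i. x $ Transposition.transpose m n i"
    have "matrix ?h = (\<chi> i. (mat 1 :: real^'n^'n) $ Transposition.transpose m n i)"
      by (simp add: matrix_def mat_def axis_def vec_eq_iff)
    then have "\<bar>det (matrix ?h)\<bar> = 1"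
      by (simp add: det_permute_rows permutes_swap_id sign_swap_id)
    then show "Q ?h"
      by (intro unimodular measure_swap_coordinates_cbox) (auto intro!: linearI simp: vec_eq_iff)
  next
    fix m n :: 'n
    assume "m \<noteq> n"
    let ?h = "\<lambda>x::real^'n. \<chi> i. if i = m then x $ m + x $ n else x $ i"
    have "matrix ?h = (\<chi> k. if k = m then row m (mat 1) + 1 *s row n (mat 1) else row k (mat 1))"
      by (auto simp: matrix_def mat_def axis_def vec_eq_iff row_def)
    then have "det (matrix ?h) = 1"
      using det_row_operation[OF \<open>m \<noteq> n\<close>, where A = "mat 1 :: real^'n^'n" and c = 1] by simp
    then show "Q ?h"
      by (intro unimodular measure_shear_cbox \<open>m \<noteq> n\<close>) (auto intro!: linearI simp: vec_eq_iff algebra_simps)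
  qed
  then show "f ` S \<in> lmeasurable" "measure lebesgue (f ` S) = \<bar>det (matrix f)\<bar> * measure lebesgue S"
    using assms(2) by (auto simp: Q_def)
qed

lemma
  fixes A :: "real^'n^'n"
  assumes "S \<in> lmeasurable"
  shows lmeasurable_affine_image: "(\<lambda>y. a + A *v y) ` S \<in> lmeasurable"
    and measure_affine_image: "measure lebesgue ((\<lambda>y. a + A *v y) ` S) = \<bar>det A\<bar> * measure lebesgue S"
proof -
  have "(\<lambda>y. a + A *v y) ` S = (+) a ` ((*v) A ` S)" by (simp add: image_image)
  then show "(\<lambda>y. a + A *v y) ` S \<in> lmeasurable"
      "measure lebesgue ((\<lambda>y. a + A *v y) ` S) = \<bar>det A\<bar> * measure lebesgue S"
    using lmeasurable_linear_image_cart[OF matrix_vector_mul_linear assms, of A]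
      measure_linear_image_cart[OF matrix_vector_mul_linear assms, of A]
    by (simp_all add: measurable_translation measure_translation)
qed

text \<open>A convex set need not be Borel, but it differs from its interior by a subset of its
  frontier, which is a null set.\<close>

lemma convex_imp_lebesgue_measurable:
  fixes S :: "'a::euclidean_space set"
  assumes "convex S"
  shows "S \<in> sets lebesgue"
proof -
  have "S - interior S \<subseteq> frontier S" using closure_subset by (auto simp: frontier_def)
  then have "negligible (S - interior S)"
    using negligible_convex_frontier[OF assms] negligible_subset by blast
  then have "interior S \<union> (S - interior S) \<in> sets lebesgue"
    by (intro sets.Un) (auto simp: negligible_imp_sets)
  then show ?thesis using interior_subset[of S] by (simp add: Un_absorb1)
qed

section \<open>Ellipsoids in convex bodies\<close>

text \<open>The matrix is not determined by the set: \<open>A\<close> and \<open>A ** Q\<close> with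
  \<open>Q\<close> orthogonal give the same ellipsoid.\<close>

definition ellipsoid :: "real^'n^'n \<Rightarrow> real^'n \<Rightarrow> (real^'n) set" where
  "ellipsoid A a = (\<lambda>y. a + A *v y) ` cball 0 1"

lemma lmeasurable_ellipsoid: "ellipsoid A a \<in> lmeasurable"
  unfolding ellipsoid_def by (rule lmeasurable_affine_image) simp

lemma measure_ellipsoid:
  fixes A :: "real^'n^'n"
  shows "measure lebesgue (ellipsoid A a) = \<bar>det A\<bar> * unit_ball_vol (CARD('n))"
  unfolding ellipsoid_def by (subst measure_affine_image) (simp_all add: content_cball)

text \<open>A comparison of support functions in a direction n of norm \<open>\<nu>\<close> with
  component \<open>s\<close> along the unit vector e. The hull of the unit ball and the point t e
  has support \<open>m\<close>. The ellipsoid centred at \<open>\<epsilon>\<close> e with semi-axis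
  \<open>1 + \<epsilon>\<close> along e and \<open>sqrt \<beta>\<close> across has support
  \<open>\<epsilon> * s\<close> plus the root of the left-hand side. The identity \<open>key\<close>
  factors the gap: one factor vanishes at the contact point - e, the other where the ellipsoid
  touches the cone with apex t e.\<close>

lemma stretched_support_bound:
  fixes s \<nu> t \<epsilon> :: real
  assumes "\<bar>s\<bar> \<le> \<nu>" "1 < t" "0 \<le> \<epsilon>" "2 * \<epsilon> \<le> t - 1"
  defines "\<beta> \<equiv> 1 - 2 * \<epsilon> / (t - 1)" and "m \<equiv> max \<nu> (t * s)"
  shows "\<beta> * \<nu>\<^sup>2 + ((1 + \<epsilon>)\<^sup>2 - \<beta>) * s\<^sup>2 \<le> (m - \<epsilon> * s)\<^sup>2" and "0 \<le> m - \<epsilon> * s"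
proof -
  have key: "(n - \<epsilon> * s)\<^sup>2 - (\<beta> * n\<^sup>2 + ((1 + \<epsilon>)\<^sup>2 - \<beta>) * s\<^sup>2) = 2 * \<epsilon> / (t - 1) * ((n - t * s) * (n + s))" for n
  proof -
    define c where "c = \<epsilon> / (t - 1)"
    have c: "\<epsilon> = c * (t - 1)" "\<beta> = 1 - 2 * c" using assms(2) by (auto simp: c_def \<beta>_def)
    have "2 * \<epsilon> / (t - 1) = 2 * c" by (simp add: c_def)
    then show ?thesis unfolding c by (simp add: power2_eq_square algebra_simps)
  qed
  have c0: "0 \<le> 2 * \<epsilon> / (t - 1)" "0 \<le> \<beta>" using assms(2-4) by (auto simp: \<beta>_def)
  show "\<beta> * \<nu>\<^sup>2 + ((1 + \<epsilon>)\<^sup>2 - \<beta>) * s\<^sup>2 \<le> (m - \<epsilon> * s)\<^sup>2"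
  proof (cases "t * s \<le> \<nu>")
    case True
    then have "0 \<le> (\<nu> - t * s) * (\<nu> + s)" using assms(1) by (intro mult_nonneg_nonneg) auto
    then have "0 \<le> 2 * \<epsilon> / (t - 1) * ((\<nu> - t * s) * (\<nu> + s))" by (rule mult_nonneg_nonneg[OF c0(1)])
    with key[of \<nu>] True show ?thesis by (simp add: m_def)
  next
    case False
    then have "\<nu>\<^sup>2 \<le> (t * s)\<^sup>2" using assms(1) by (intro power_mono) auto
    then have "\<beta> * \<nu>\<^sup>2 \<le> \<beta> * (t * s)\<^sup>2" using c0 by (intro mult_left_mono)
    with key[of "t * s"] False show ?thesis by (simp add: m_def)
  qed
  show "0 \<le> m - \<epsilon> * s"
  proof (cases "0 \<le> s")
    case True
    then have "\<epsilon> * s \<le> t * s" using assms(2-4) by (intro mult_right_mono) auto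
    then show ?thesis by (simp add: m_def)
  next
    case False
    then have "\<epsilon> * s \<le> 0" using assms(3) by (simp add: mult_nonneg_nonpos)
    moreover have "0 \<le> \<nu>" using assms(1) by simp
    ultimately show ?thesis by (simp add: m_def)
  qed
qed

text \<open>The ellipsoid has its semi-axis of length \<open>1 + \<epsilon>\<close> along \<open>x\<close> and touches the unit ball at
  \<open>- x / norm x\<close>; the remaining semi-axes \<open>b\<close> are as large as the cone over the ball with apex \<open>x\<close> permits.\<close>

lemma stretched_ellipsoid_subset:
  fixes K :: "(real^'n) set"
  assumes K: "convex K" "closed K" "cball 0 1 \<subseteq> K" and x: "x \<in> K" "norm x = t" "1 < t"
    and \<epsilon>: "0 \<le> \<epsilon>" "2 * \<epsilon> \<le> t - 1" and b: "0 \<le> b" "b\<^sup>2 = 1 - 2 * \<epsilon> / (t - 1)"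
  obtains M c where "\<bar>det M\<bar> = (1 + \<epsilon>) * b ^ (CARD('n) - 1)" "ellipsoid M c \<subseteq> K"
proof -
  define e where "e = x /\<^sub>R t"
  have e: "norm e = 1" "x = t *\<^sub>R e" using x by (auto simp: e_def)
  fix k :: 'n
  obtain P where P: "orthogonal_matrix P" "P *v axis k 1 = e"
    using orthogonal_matrix_exists_basis[OF e(1)] by metis
  define l where "l i = (if i = k then 1 + \<epsilon> else b)" for i
  define M where "M = P ** diagonal_matrix l"
  have "prod l UNIV = l k * prod l (UNIV - {k})" by (rule prod.remove) auto
  also have "prod l (UNIV - {k}) = (\<Prod>i\<in>UNIV - {k}. b)" by (rule prod.cong) (auto simp: l_def)
  finally have "prod l UNIV = (1 + \<epsilon>) * b ^ (CARD('n) - 1)" by (simp add: l_def card_Diff_singleton)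
  moreover have "\<bar>det P\<bar> = 1" using det_orthogonal_matrix[OF P(1)] by auto
  ultimately have det: "\<bar>det M\<bar> = (1 + \<epsilon>) * b ^ (CARD('n) - 1)"
    using \<epsilon> b by (simp add: M_def det_mul det_diagonal_matrix abs_mult)
  have "ellipsoid M (\<epsilon> *\<^sub>R e) \<subseteq> K"
  proof
    fix p assume "p \<in> ellipsoid M (\<epsilon> *\<^sub>R e)"
    then obtain y where y: "norm y \<le> 1" "p = \<epsilon> *\<^sub>R e + M *v y" by (auto simp: ellipsoid_def)
    show "p \<in> K"
    proof (rule ccontr)
      assume "p \<notin> K"
      then obtain u \<beta> where u: "u \<bullet> p < \<beta>" "\<And>z. z \<in> K \<Longrightarrow> u \<bullet> z > \<beta>"
        using separating_hyperplane_closed_point[OF K(1,2)] by metis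
      \<comment> \<open>The normal \<open>n\<close> points out of \<open>K\<close>. Separation from
        the unit ball and from \<open>x\<close> bounds \<open>n \<bullet> p\<close> below by the
        support function of their hull, while \<open>w\<close>, the coordinates of \<open>n\<close>
        in the frame \<open>P\<close>, computes the support of the ellipsoid.\<close>
      define n where "n = - u"
      define s where "s = n \<bullet> e"
      define w where "w = transpose P *v n"
      have sep: "n \<bullet> z < n \<bullet> p" if "z \<in> K" for z using u(2)[OF that] u(1) by (simp add: n_def)
      have "norm n < n \<bullet> p"
      proof (cases "n = 0")
        case True
        have "n \<bullet> 0 < n \<bullet> p" using K(3) by (intro sep) auto
        then show ?thesis using True by simp
      next
        case False
        then have "n /\<^sub>R norm n \<in> K" using K(3) by auto
        from sep[OF this] show ?thesis using False
          by (simp add: inner_simps power2_norm_eq_inner[symmetric] power2_eq_square mult.assoc[symmetric])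
      qed
      moreover have "t * s < n \<bullet> p" using sep[OF x(1)] by (simp add: s_def e(2))
      ultimately have max: "max (norm n) (t * s) < n \<bullet> p" by simp
      have "\<bar>s\<bar> \<le> norm n" using Cauchy_Schwarz_ineq2[of n e] e(1) by (simp add: s_def)
      note bound = stretched_support_bound[OF this x(3) \<epsilon>]
      have wk: "w $ k = s"
        using inner_transpose_matrix_vector[of P n "axis k 1"] P(2) by (simp add: w_def s_def inner_axis)
      have "w \<bullet> w = n \<bullet> n"
        using P(1) inner_transpose_matrix_vector[of P n w]
        by (simp add: w_def matrix_vector_mul_assoc orthogonal_matrix_def del: transpose_matrix_vector)
      then have ww: "(\<Sum>i\<in>UNIV. (w $ i)\<^sup>2) = (norm n)\<^sup>2"
        unfolding power2_norm_eq_inner by (simp add: inner_vec_def power2_eq_square)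
      have "(norm (diagonal_matrix l *v w))\<^sup>2 = (\<Sum>i\<in>UNIV. (l i * w $ i)\<^sup>2)"
        unfolding power2_norm_eq_inner
        by (simp add: inner_vec_def diagonal_matrix_mult_vec power2_eq_square)
      also have "\<dots> = (\<Sum>i\<in>UNIV. b\<^sup>2 * (w $ i)\<^sup>2 + (if i = k then ((1 + \<epsilon>)\<^sup>2 - b\<^sup>2) * (w $ i)\<^sup>2 else 0))"
        by (rule sum.cong) (auto simp: l_def power_mult_distrib algebra_simps)
      also have "\<dots> = b\<^sup>2 * (norm n)\<^sup>2 + ((1 + \<epsilon>)\<^sup>2 - b\<^sup>2) * s\<^sup>2"
        by (simp add: sum.distrib sum_distrib_left[symmetric] ww wk)
      also have "\<dots> \<le> (max (norm n) (t * s) - \<epsilon> * s)\<^sup>2"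
        using bound(1) by (simp add: b(2))
      finally have "norm (diagonal_matrix l *v w) \<le> max (norm n) (t * s) - \<epsilon> * s"
        using bound(2) by (rule power2_le_imp_le)
      moreover have "n \<bullet> (M *v y) \<le> norm (diagonal_matrix l *v w)"
      proof -
        have "n \<bullet> (M *v y) = w \<bullet> (diagonal_matrix l *v y)"
          unfolding w_def inner_transpose_matrix_vector by (simp add: M_def matrix_vector_mul_assoc)
        also have "\<dots> = (diagonal_matrix l *v w) \<bullet> y"
          using inner_transpose_matrix_vector[of "diagonal_matrix l" w y] by simp
        also have "\<dots> \<le> norm (diagonal_matrix l *v w) * norm y" by (rule norm_cauchy_schwarz)
        also have "\<dots> \<le> norm (diagonal_matrix l *v w)" using y(1) by (simp add: mult_left_le)
        finally show ?thesis .
      qed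
      moreover have "n \<bullet> p = \<epsilon> * s + n \<bullet> (M *v y)" by (simp add: y(2) inner_simps s_def)
      ultimately show False using max by simp
    qed
  qed
  with det that show thesis by blast
qed

text \<open>The preimage of \<open>K\<close> under the affine map of \<open>(A, a)\<close> is closed
  and convex and contains the unit ball, so the case of the ball applies there.\<close>

lemma enlarged_ellipsoid_subset:
  fixes K :: "(real^'n) set"
  assumes K: "convex K" "closed K" "ellipsoid A a \<subseteq> K" and y: "a + A *v y \<in> K" "norm y = t" "1 < t"
    and \<epsilon>: "0 \<le> \<epsilon>" "2 * \<epsilon> \<le> t - 1" and b: "0 \<le> b" "b\<^sup>2 = 1 - 2 * \<epsilon> / (t - 1)"
  obtains M c where "\<bar>det M\<bar> = \<bar>det A\<bar> * ((1 + \<epsilon>) * b ^ (CARD('n) - 1))" "ellipsoid M c \<subseteq> K"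
proof -
  define K' where "K' = (\<lambda>z. a + A *v z) -` K"
  have "closed K'" unfolding K'_def
    by (intro continuous_closed_vimage K(2) continuous_intros)
  moreover have "K' = (*v) A -` ((\<lambda>z. - a + z) ` K)"
    unfolding K'_def by (auto simp: image_iff) (metis add_diff_cancel_left' diff_conv_add_uminus add.commute)
  then have "convex K'"
    using K(1) by (simp add: convex_linear_vimage convex_translation)
  moreover have "cball 0 1 \<subseteq> K'" using K(3) by (auto simp: K'_def ellipsoid_def)
  moreover have "y \<in> K'" using y by (simp add: K'_def)
  ultimately obtain M c where M: "\<bar>det M\<bar> = (1 + \<epsilon>) * b ^ (CARD('n) - 1)" "ellipsoid M c \<subseteq> K'"
    using stretched_ellipsoid_subset[of K' y t \<epsilon> b] y \<epsilon> b by blast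
  have eq: "a + A *v c + (A ** M) *v z = a + A *v (c + M *v z)" for z
    by (simp add: matrix_vector_right_distrib matrix_vector_mul_assoc)
  have "ellipsoid (A ** M) (a + A *v c) \<subseteq> K"
    using M(2) by (auto simp: ellipsoid_def K'_def eq)
  moreover have "\<bar>det (A ** M)\<bar> = \<bar>det A\<bar> * ((1 + \<epsilon>) * b ^ (CARD('n) - 1))"
    by (simp add: det_mul abs_mult M(1))
  ultimately show thesis using that by blast
qed

section \<open>Finite volume and the gain from stretching\<close>

lemma mat_mult_vec: "mat \<rho> *v y = \<rho> *\<^sub>R y" for y :: "real^'n"
  by (simp add: mat_def matrix_vector_mult_def vec_eq_iff if_distrib[of "\<lambda>u. u * _"] cong: if_cong)

lemma ellipsoid_scaled_identity:
  fixes z :: "real^'n"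
  assumes "0 < \<rho>"
  shows "ellipsoid (mat \<rho>) z = cball z \<rho>"
proof -
  have "ellipsoid (mat \<rho>) z = (+) z ` ((*\<^sub>R) \<rho> ` cball 0 1)"
    by (simp add: ellipsoid_def image_image mat_mult_vec)
  then show ?thesis using assms by (simp add: cball_scale)
qed

lemma det_scaled_identity: "det (mat \<rho> :: real^'n^'n) = \<rho> ^ CARD('n)"
  by (subst det_diagonal) (auto simp: mat_def)

text \<open>Stretching a fixed ball in \<open>K\<close> towards a far point of \<open>K\<close>
  gives inscribed ellipsoids whose volume grows linearly with the distance.\<close>

lemma convex_finite_measure_imp_bounded:
  fixes K :: "(real^'n) set"
  assumes K: "convex K" "closed K" "interior K \<noteq> {}" "K \<in> lmeasurable"
  shows "bounded K"
proof (rule ccontr)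
  assume unbounded: "\<not> bounded K"
  obtain z \<rho> where z: "0 < \<rho>" "cball z \<rho> \<subseteq> K"
    using K(3) by (metis ex_in_conv mem_interior_cball)
  define b where "b = sqrt (1 / 2)"
  have b: "0 < b" "b\<^sup>2 = 1 / 2" by (auto simp: b_def)
  define \<omega> where "\<omega> = unit_ball_vol (real CARD('n))"
  have "\<omega> > 0" by (simp add: \<omega>_def)
  define q where "q = \<rho> ^ CARD('n) * b ^ (CARD('n) - 1) * \<omega>"
  have "q > 0" using z b \<open>\<omega> > 0\<close> by (simp add: q_def)
  \<comment> \<open>Chosen so that \<open>(T - 1) / 4 * q\<close> is the measure of
    \<open>K\<close>. With \<open>\<epsilon> = (t - 1) / 4\<close> the remaining semi-axes shrink by
    the factor \<open>b\<close> independently of \<open>t\<close>, so the stretched ellipsoid has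
    volume \<open>(1 + \<epsilon>) * q\<close>, which is too large once t > T.\<close>
  define T where "T = 1 + 4 * measure lebesgue K / q"
  have "T \<ge> 1" using \<open>q > 0\<close> by (simp add: T_def)
  obtain x where x: "x \<in> K" "norm x > norm z + \<rho> * T"
    using unbounded by (auto simp: bounded_iff not_le)
  define y where "y = (x - z) /\<^sub>R \<rho>"
  define t where "t = norm y"
  have zy: "z + mat \<rho> *v y = x" using z by (simp add: y_def mat_mult_vec)
  have "norm (x - z) > \<rho> * T" using x(2) norm_triangle_ineq2[of x z] by linarith
  moreover have "t = norm (x - z) / \<rho>" using z(1) by (simp add: t_def y_def divide_inverse_commute)
  ultimately have "t > T" using z(1) by (simp add: pos_less_divide_eq mult.commute)
  define \<epsilon> where "\<epsilon> = (t - 1) / 4"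
  have "\<epsilon> > 0" "2 * \<epsilon> \<le> t - 1" "b\<^sup>2 = 1 - 2 * \<epsilon> / (t - 1)"
    using \<open>t > T\<close> \<open>T \<ge> 1\<close> unfolding b(2) by (auto simp: \<epsilon>_def divide_simps)
  then obtain M c where M: "\<bar>det M\<bar> = \<bar>det (mat \<rho> :: real^'n^'n)\<bar> * ((1 + \<epsilon>) * b ^ (CARD('n) - 1))"
      "ellipsoid M c \<subseteq> K"
    using enlarged_ellipsoid_subset[OF K(1,2), of "mat \<rho>" z y t \<epsilon> b] x z zy b \<open>t > T\<close> \<open>T \<ge> 1\<close>
    by (auto simp: t_def[symmetric] ellipsoid_scaled_identity)
  have "(1 + \<epsilon>) * q = measure lebesgue (ellipsoid M c)"
    using M(1) z(1) by (simp add: measure_ellipsoid det_scaled_identity q_def \<omega>_def)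
  also have "\<dots> \<le> measure lebesgue K"
    using M(2) K(4) lmeasurable_ellipsoid by (intro measure_mono_fmeasurable) (auto intro: fmeasurableD)
  also have "\<dots> = (T - 1) / 4 * q" using \<open>q > 0\<close> by (simp add: T_def)
  finally have "1 + \<epsilon> \<le> (T - 1) / 4" using \<open>q > 0\<close> by (simp add: mult_le_cancel_right)
  then show False using \<open>t > T\<close> by (simp add: \<epsilon>_def field_simps)
qed

text \<open>The origin of the dilation factor d: the squared volume ratio has derivative 2 - 2 (d -
  1) / (t - 1) at \<open>\<epsilon> = 0\<close>, which is positive exactly when t > d. Squaring
  removes the root in the length of the shrunken semi-axes.\<close>

lemma stretch_increases_volume:
  fixes t :: real
  assumes "real d < t" "1 \<le> d"
  obtains \<epsilon> where "0 < \<epsilon>" "2 * \<epsilon> \<le> t - 1" "1 < (1 + \<epsilon>)\<^sup>2 * (1 - 2 * \<epsilon> / (t - 1)) ^ (d - 1)"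
proof -
  define q where "q = real (d - 1) / (t - 1)"
  have t: "t > 1" using assms by linarith
  have q: "0 \<le> q" "q < 1" using assms t by (auto simp: q_def of_nat_diff)
  \<comment> \<open>The first bound keeps the base of the power nonnegative. The second makes the
    quadratic loss at most half of the linear gain \<open>2 * \<epsilon> * (1 - q)\<close>;
    Bernoulli's inequality handles the power.\<close>
  define \<epsilon> where "\<epsilon> = min ((t - 1) / 2) ((1 - q) / 4)"
  have "\<epsilon> \<le> (t - 1) / 2" "\<epsilon> \<le> (1 - q) / 4"
    unfolding \<epsilon>_def by (rule min.cobounded1 min.cobounded2)+
  then have \<epsilon>: "0 < \<epsilon>" "\<epsilon> \<le> (t - 1) / 2" "4 * \<epsilon> \<le> 1 - q" using t q by (auto simp: \<epsilon>_def)
  have "2 * \<epsilon> * q \<le> 2 * \<epsilon>" using q \<epsilon>(1) by (simp add: mult_left_le)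
  also have "\<dots> \<le> (1 - q) / 2" using \<epsilon>(3) by simp
  finally have small: "2 * \<epsilon> * q \<le> (1 - q) / 2" .
  have "\<epsilon> * (2 * \<epsilon> * q) \<le> \<epsilon> * ((1 - q) / 2)" using small \<epsilon>(1) by (intro mult_left_mono) auto
  moreover have "0 < \<epsilon> * (1 - q)" using \<epsilon>(1) q by simp
  ultimately have "1 < (1 + 2 * \<epsilon>) * (1 - 2 * \<epsilon> * q)" by (simp add: algebra_simps)
  also have "\<dots> \<le> (1 + \<epsilon>)\<^sup>2 * (1 - 2 * \<epsilon> * q)"
    using small q by (intro mult_right_mono) (auto simp: power2_eq_square algebra_simps)
  also have "1 - 2 * \<epsilon> * q \<le> (1 - 2 * \<epsilon> / (t - 1)) ^ (d - 1)"
  proof -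
    have "- 1 \<le> - (2 * \<epsilon> / (t - 1))" using \<epsilon>(2) t by simp
    from Bernoulli_inequality[OF this, of "d - 1"] show ?thesis by (simp add: q_def mult.commute)
  qed
  then have "(1 + \<epsilon>)\<^sup>2 * (1 - 2 * \<epsilon> * q) \<le> (1 + \<epsilon>)\<^sup>2 * (1 - 2 * \<epsilon> / (t - 1)) ^ (d - 1)"
    by (intro mult_left_mono) auto
  finally show thesis using that[of \<epsilon>] \<epsilon> by simp
qed

section \<open>Maximal inscribed ellipsoids\<close>

lemma continuous_on_det:
  fixes f :: "'a::topological_space \<Rightarrow> real^'n^'n"
  assumes "continuous_on S f"
  shows "continuous_on S (\<lambda>x. det (f x))"
  unfolding det_def by (intro continuous_intros assms)

text \<open>Each point of the unit ball imposes a closed condition on \<open>(A, a)\<close>.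
  Boundedness holds because \<open>a\<close> and its sums with the columns of \<open>A\<close> lie
  in \<open>K\<close>.\<close>

lemma compact_inscribed_ellipsoids:
  fixes K :: "(real^'n) set"
  assumes "compact K"
  shows "compact {(A, a). ellipsoid A a \<subseteq> K}"
proof -
  define G where "G = {(A :: real^'n^'n, a). ellipsoid A a \<subseteq> K}"
  have cont: "continuous_on UNIV (\<lambda>g :: (real^'n^'n) \<times> (real^'n). snd g + fst g *v y)" for y
    by (intro linear_continuous_on linear_conv_bounded_linear[THEN iffD1] linearI)
      (auto simp: matrix_vector_mult_add_rdistrib scaleR_matrix_vector_assoc algebra_simps)
  have "G = (\<Inter>y\<in>cball 0 1. (\<lambda>g. snd g + fst g *v y) -` K)"
    by (auto simp: G_def ellipsoid_def)
  moreover have "closed ((\<lambda>g. snd g + fst g *v y) -` K)" for y :: "real^'n"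
    by (rule closed_vimage[OF compact_imp_closed[OF assms] cont])
  ultimately have "closed G" by (simp add: closed_INT)
  moreover have "bounded G"
  proof -
    obtain R where R: "\<And>x. x \<in> K \<Longrightarrow> norm x \<le> R"
      using compact_imp_bounded[OF assms] by (auto simp: bounded_iff)
    have "norm (A, a) \<le> (\<Sum>i\<in>(UNIV::'n set). \<Sum>j\<in>(UNIV::'n set). 2 * R) + R" if "(A, a) \<in> G" for A a
    proof -
      have in_K: "a + A *v y \<in> K" if "norm y \<le> 1" for y
        using \<open>(A, a) \<in> G\<close> that by (auto simp: G_def ellipsoid_def)
      have a: "norm a \<le> R" using R[OF in_K[of 0]] by simp
      have "\<bar>A $ i $ j\<bar> \<le> 2 * R" for i j
      proof -
        have "\<bar>A $ i $ j\<bar> \<le> norm (A *v axis j 1)"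
          using component_le_norm_cart[of "A *v axis j 1" i] by (simp add: matrix_vector_mult_basis column_def)
        also have "\<dots> \<le> norm (a + A *v axis j 1) + norm a"
          using norm_triangle_ineq4[of "a + A *v axis j 1" a] by simp
        also have "\<dots> \<le> 2 * R" using R[OF in_K[of "axis j 1"]] a by (simp add: norm_axis_1)
        finally show ?thesis .
      qed
      then have "norm (A $ i) \<le> (\<Sum>j\<in>(UNIV::'n set). 2 * R)" for i
        using norm_le_l1_cart[of "A $ i"] by (meson order_trans sum_mono)
      then have "(\<Sum>i\<in>UNIV. norm (A $ i)) \<le> (\<Sum>i\<in>(UNIV::'n set). \<Sum>j\<in>(UNIV::'n set). 2 * R)"
        by (rule sum_mono)
      moreover have "norm A \<le> (\<Sum>i\<in>UNIV. norm (A $ i))"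
        unfolding norm_vec_def[of A] by (simp add: L2_set_le_sum)
      ultimately have "norm A \<le> (\<Sum>i\<in>(UNIV::'n set). \<Sum>j\<in>(UNIV::'n set). 2 * R)"
        by (rule order_trans[rotated])
      then show ?thesis using a norm_Pair_le[of A a] by linarith
    qed
    then show ?thesis unfolding bounded_iff by (metis surj_pair)
  qed
  ultimately show ?thesis unfolding G_def by (simp add: compact_eq_bounded_closed)
qed

lemma ellipsoid_mult_orthogonal:
  assumes "orthogonal_matrix Q"
  shows "ellipsoid (A ** Q) a \<subseteq> ellipsoid A a"
proof -
  have "norm (Q *v y) = norm y" for y
    using assms by (simp add: orthogonal_transformation_matrix orthogonal_transformation_norm)
  then show ?thesis
    by (auto simp: ellipsoid_def matrix_vector_mul_assoc[symmetric])
qed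

text \<open>John's theorem. Among the inscribed ellipsoids of maximal volume, each of which is the image of
  the ball under many matrices, the matrix of largest trace is positive semidefinite.\<close>

theorem john_ellipsoid:
  fixes K :: "(real^'n) set"
  assumes K: "compact K" "convex K" "interior K \<noteq> {}"
  obtains A a where "positive_semidefinite A" "0 < det A" "ellipsoid A a \<subseteq> K"
    "K \<subseteq> (\<lambda>y. a + A *v y) ` cball 0 (CARD('n))"
proof -
  define G where "G = {(A :: real^'n^'n, a). ellipsoid A a \<subseteq> K}"
  have "compact G" unfolding G_def by (rule compact_inscribed_ellipsoids[OF K(1)])
  obtain z \<rho> where z: "0 < \<rho>" "cball z \<rho> \<subseteq> K"
    using K(3) by (metis ex_in_conv mem_interior_cball)
  then have "(mat \<rho>, z) \<in> G" by (simp add: G_def ellipsoid_scaled_identity)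
  have cont: "continuous_on G (\<lambda>g. \<bar>det (fst g)\<bar>)"
    by (intro continuous_intros continuous_on_det)
  obtain g where g: "g \<in> G" "\<And>h. h \<in> G \<Longrightarrow> \<bar>det (fst h)\<bar> \<le> \<bar>det (fst g)\<bar>"
    using continuous_attains_sup[OF \<open>compact G\<close> _ cont] \<open>(mat \<rho>, z) \<in> G\<close> by blast
  define \<mu> where "\<mu> = \<bar>det (fst g)\<bar>"
  have "\<mu> > 0" using g(2)[OF \<open>(mat \<rho>, z) \<in> G\<close>] z(1) unfolding \<mu>_def
    by (simp add: det_scaled_identity) (smt (verit) zero_less_power)
  define G' where "G' = {h \<in> G. \<bar>det (fst h)\<bar> = \<mu>}"
  have "closed G'"
    unfolding G'_def using continuous_closed_preimage_constant[OF cont compact_imp_closed[OF \<open>compact G\<close>]] .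
  moreover have "G' \<subseteq> G" by (auto simp: G'_def)
  ultimately have "compact G'" using \<open>compact G\<close> by (metis compact_Int_closed inf.absorb_iff2)
  moreover have "g \<in> G'" using g by (simp add: G'_def \<mu>_def)
  moreover have "continuous_on G' (\<lambda>h. trace (fst h))"
    unfolding trace_def by (intro continuous_intros)
  ultimately obtain h where h: "h \<in> G'" "\<And>k. k \<in> G' \<Longrightarrow> trace (fst k) \<le> trace (fst h)"
    using continuous_attains_sup[of G' "\<lambda>h. trace (fst h)"] by blast
  obtain A a where Aa: "h = (A, a)" by (cases h)
  have A: "ellipsoid A a \<subseteq> K" "\<bar>det A\<bar> = \<mu>" using h(1) by (auto simp: Aa G'_def G_def)
  have psd: "positive_semidefinite A"
  proof (rule trace_maximal_imp_positive_semidefinite)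
    fix Q :: "real^'n^'n" assume Q: "orthogonal_matrix Q"
    then have "\<bar>det (A ** Q)\<bar> = \<mu>"
      using A(2) det_orthogonal_matrix[OF Q] by (auto simp: det_mul)
    then have "(A ** Q, a) \<in> G'"
      using ellipsoid_mult_orthogonal[OF Q, of A a] A(1) by (auto simp: G'_def G_def)
    from h(2)[OF this] show "trace (A ** Q) \<le> trace A" by (simp add: Aa)
  qed
  have "0 < det A" using positive_semidefinite_det(1)[OF psd] A(2) \<open>\<mu> > 0\<close> by auto
  have "K \<subseteq> (\<lambda>y. a + A *v y) ` cball 0 (CARD('n))"
  proof
    fix x assume "x \<in> K"
    have "invertible A" using \<open>0 < det A\<close> by (simp add: invertible_det_nz)
    then obtain B where "A ** B = mat 1" unfolding invertible_def by auto
    define y where "y = B *v (x - a)"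
    have xy: "x = a + A *v y"
      by (simp add: y_def matrix_vector_mul_assoc \<open>A ** B = mat 1\<close>)
    \<comment> \<open>If \<open>x\<close> were outside the dilate, stretching the ellipsoid towards
      \<open>x\<close> would give an inscribed ellipsoid of volume larger than the maximum.\<close>
    have "norm y \<le> CARD('n)"
    proof (rule ccontr)
      define t where "t = norm y"
      assume "\<not> norm y \<le> CARD('n)"
      then have t: "real CARD('n) < t" by (simp add: t_def)
      obtain \<epsilon> where \<epsilon>: "0 < \<epsilon>" "2 * \<epsilon> \<le> t - 1" "1 < (1 + \<epsilon>)\<^sup>2 * (1 - 2 * \<epsilon> / (t - 1)) ^ (CARD('n) - 1)"
        using stretch_increases_volume[OF t] by (metis One_nat_def Suc_leI zero_less_card_finite)
      define b where "b = sqrt (1 - 2 * \<epsilon> / (t - 1))"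
      have "1 < t" using \<epsilon> by linarith
      then have b: "0 \<le> b" "b\<^sup>2 = 1 - 2 * \<epsilon> / (t - 1)" using \<epsilon>(2) by (auto simp: b_def)
      obtain M c where M: "\<bar>det M\<bar> = \<bar>det A\<bar> * ((1 + \<epsilon>) * b ^ (CARD('n) - 1))" "ellipsoid M c \<subseteq> K"
        using enlarged_ellipsoid_subset[OF K(2) compact_imp_closed[OF K(1)] A(1), of y t \<epsilon> b]
          \<open>x \<in> K\<close> xy \<open>1 < t\<close> \<epsilon> b by (auto simp: t_def)
      have "((1 + \<epsilon>) * b ^ (CARD('n) - 1))\<^sup>2 = (1 + \<epsilon>)\<^sup>2 * (b\<^sup>2) ^ (CARD('n) - 1)"
        by (simp only: power_mult_distrib power_mult[symmetric] mult.commute)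
      then have "1 < ((1 + \<epsilon>) * b ^ (CARD('n) - 1))\<^sup>2"
        using \<epsilon>(3) unfolding b(2) by simp
      then have "1 < (1 + \<epsilon>) * b ^ (CARD('n) - 1)"
        using \<epsilon>(1) b(1) by (intro power2_less_imp_less[of 1]) auto
      then have "\<mu> < \<bar>det M\<bar>" using M(1) A(2) \<open>\<mu> > 0\<close> by simp
      moreover have "\<bar>det M\<bar> \<le> \<mu>" using g(2)[of "(M, c)"] M(2) by (simp add: G_def \<mu>_def)
      ultimately show False by simp
    qed
    then show "x \<in> (\<lambda>y. a + A *v y) ` cball 0 (CARD('n))" using xy by auto
  qed
  with psd \<open>0 < det A\<close> A(1) that show thesis by blast
qed

text \<open>The closed hull of an unbounded set can have infinite volume, while John's theorem needs
  a compact body. In that case balls exhaust the set until the volume exceeds 1; otherwise finite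
  volume already forces boundedness.\<close>

lemma compact_convex_subset_measure_ge_1:
  fixes C :: "(real^'n) set"
  assumes C: "convex C" "closed C" and ge: "1 \<le> emeasure lebesgue C"
  obtains K where "compact K" "convex K" "K \<subseteq> C" "1 \<le> emeasure lebesgue K"
proof (cases "emeasure lebesgue C = \<infinity>")
  case True
  define K where "K n = C \<inter> cball 0 (real n)" for n
  have K: "compact (K n)" "convex (K n)" "K n \<subseteq> C" for n
    using C by (auto simp: K_def closed_Int_compact convex_Int)
  have "incseq K" by (auto simp: incseq_def K_def)
  moreover have "range K \<subseteq> sets lebesgue"
    using K(2) convex_imp_lebesgue_measurable by blast
  moreover have "(\<Union>n. K n) = C" by (auto simp: K_def real_arch_simple)
  ultimately have "(SUP n. emeasure lebesgue (K n)) = \<infinity>"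
    using SUP_emeasure_incseq[of K lebesgue] True by simp
  then have "1 < (SUP n. emeasure lebesgue (K n))"
    by (metis ennreal_one_less_top infinity_ennreal_def)
  then obtain n where "1 < emeasure lebesgue (K n)" by (auto simp: less_SUP_iff)
  then show ?thesis using that[of "K n"] K by auto
next
  case False
  then have lm: "C \<in> lmeasurable"
    using convex_imp_lebesgue_measurable[OF C(1)] by (intro fmeasurableI) (auto simp: top.not_eq_extremum)
  have "interior C \<noteq> {}"
  proof
    assume "interior C = {}"
    then have "emeasure lebesgue C = 0"
      using negligible_convex_interior[OF C(1)] by (auto simp: negligible_iff_emeasure0 lm fmeasurableD)
    then show False using ge by simp
  qed
  then have "compact C"
    using convex_finite_measure_imp_bounded[OF C _ lm] C(2) by (simp add: compact_eq_bounded_closed)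
  then show ?thesis using that C ge by auto
qed

theorem inscribed_ellipsoid_of_volume:
  fixes F :: "(real^'n) set"
  assumes F: "F \<in> sets lebesgue" "emeasure lebesgue F = 1"
  obtains A a where "positive_semidefinite A"
    "1 / real CARD('n) ^ CARD('n) \<le> det A * unit_ball_vol (real CARD('n))"
    "(\<lambda>y. a + A *v y) ` ball 0 1 \<subseteq> convex hull F"
proof -
  let ?d = "CARD('n)" and ?\<omega> = "unit_ball_vol (real CARD('n))"
  define C where "C = closure (convex hull F)"
  have "convex C" "closed C" by (auto simp: C_def convex_closure)
  have "F \<subseteq> C" using hull_subset[of F convex] closure_subset[of "convex hull F"] by (auto simp: C_def)
  then have "emeasure lebesgue F \<le> emeasure lebesgue C"
    by (intro emeasure_mono convex_imp_lebesgue_measurable[OF \<open>convex C\<close>])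
  then have "1 \<le> emeasure lebesgue C" using F by simp
  then obtain K where K: "compact K" "convex K" "K \<subseteq> C" "1 \<le> emeasure lebesgue K"
    using compact_convex_subset_measure_ge_1[OF \<open>convex C\<close> \<open>closed C\<close>] by blast
  have lm: "K \<in> lmeasurable" using K(1) by (rule lmeasurable_compact)
  have "interior K \<noteq> {}"
  proof
    assume "interior K = {}"
    then have "emeasure lebesgue K = 0"
      using negligible_convex_interior[OF K(2)] by (auto simp: negligible_iff_emeasure0 lm fmeasurableD)
    then show False using K(4) by simp
  qed
  then obtain A a where A: "positive_semidefinite A" "0 < det A" "ellipsoid A a \<subseteq> K"
    "K \<subseteq> (\<lambda>y. a + A *v y) ` cball 0 (CARD('n))"
    using john_ellipsoid[OF K(1,2)] by blast
  have "1 \<le> measure lebesgue K"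
    using K(4) lm by (simp add: emeasure_eq_measure2)
  \<comment> \<open>The dilate has \<open>d^d\<close> times the volume of the ellipsoid, so the
    latter is at least \<open>d^(-d)\<close>.\<close>
  also have "\<dots> \<le> measure lebesgue ((\<lambda>y. a + A *v y) ` cball 0 ?d)"
    using A(4) lm by (intro measure_mono_fmeasurable lmeasurable_affine_image) (auto intro: fmeasurableD)
  also have "\<dots> = det A * ?\<omega> * real ?d ^ ?d"
    using A(2) by (subst measure_affine_image) (simp_all add: content_cball)
  finally have vol: "1 / real ?d ^ ?d \<le> det A * ?\<omega>" by (simp add: field_simps)
  \<comment> \<open>Invertibility makes the image of the open ball open. It thus lies in the
    interior of the closed hull, which is also the interior of the hull itself.\<close>
  have "invertible A" using A(2) by (simp add: invertible_det_nz)
  then have "surj ((*v) A)" by (metis matrix_right_invertible_surjective invertible_def)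
  then have "open ((*v) A ` ball 0 1)"
    by (intro open_surjective_linear_image) auto
  then have "open ((+) a ` ((*v) A ` ball 0 1))" by (rule open_translation)
  then have "open ((\<lambda>y. a + A *v y) ` ball 0 1)" by (simp add: image_image)
  moreover have "(\<lambda>y. a + A *v y) ` ball 0 1 \<subseteq> C"
    using A(3) K(3) by (force simp: ellipsoid_def)
  ultimately have "(\<lambda>y. a + A *v y) ` ball 0 1 \<subseteq> interior C" by (simp add: interior_maximal)
  also have "interior C = interior (convex hull F)"
    by (simp add: C_def convex_interior_closure)
  also have "\<dots> \<subseteq> convex hull F" by (rule interior_subset)
  finally show thesis using that A(1) vol by blast
qed

section \<open>Coordinates for symmetric matrices with a centre\<close>

lemma card_one_or_two_element_subsets:
  "card {S :: 'd::finite set. card S = 1 \<or> card S = 2} = CARD('d) * (CARD('d) + 1) div 2"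
proof -
  let ?T = "\<lambda>k. {S :: 'd set. S \<subseteq> UNIV \<and> card S = k}"
  have "{S :: 'd set. card S = 1 \<or> card S = 2} = ?T 1 \<union> ?T 2" by auto
  also have "card (?T 1 \<union> ?T 2) = card (?T 1) + card (?T 2)"
    by (rule card_Un_disjoint) auto
  also have "\<dots> = CARD('d) + CARD('d) * (CARD('d) - 1) div 2"
    using n_subsets[of "UNIV :: 'd set" 1] n_subsets[of "UNIV :: 'd set" 2] by (simp add: choose_two)
  also have "\<dots> = CARD('d) * (CARD('d) + 1) div 2"
    by (cases "CARD('d)") (auto simp: algebra_simps)
  finally show ?thesis .
qed

text \<open>A symmetric matrix together with a vector is recorded by \<open>d (d + 3) / 2\<close> coordinates: the matrix
  entries, indexed by the sets \<open>{p, q}\<close>, and the vector entries.\<close>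

definition ellipsoid_coordinate :: "real^'d^'d \<Rightarrow> real^'d \<Rightarrow> 'd set + 'd \<Rightarrow> real" where
  "ellipsoid_coordinate A a c = (case c of Inl S \<Rightarrow> (SOME v. \<exists>p q. S = {p, q} \<and> v = A $ p $ q) | Inr p \<Rightarrow> a $ p)"

text \<open>Symmetry makes the choice independent of the order in which the indices are taken from
  the set; one-element sets carry the diagonal.\<close>

lemma ellipsoid_coordinate_Inl:
  assumes "transpose A = A"
  shows "ellipsoid_coordinate A a (Inl {p, q}) = A $ p $ q"
proof -
  have sym: "A $ p $ q = A $ q $ p" for p q
  proof -
    have "transpose A $ p $ q = A $ p $ q" using assms by simp
    then show ?thesis by (simp add: transpose_def)
  qed
  have "(SOME v. \<exists>p' q'. {p, q} = {p', q'} \<and> v = A $ p' $ q') = A $ p $ q"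
  proof (rule some_equality)
    fix v assume "\<exists>p' q'. {p, q} = {p', q'} \<and> v = A $ p' $ q'"
    then show "v = A $ p $ q" by (auto simp: doubleton_eq_iff sym)
  qed blast
  then show ?thesis by (simp add: ellipsoid_coordinate_def)
qed

lemma card_ellipsoid_coordinates:
  "card (Inl ` {S :: 'd::finite set. card S = 1 \<or> card S = 2} \<union> range (Inr :: 'd \<Rightarrow> _))
    = CARD('d) * (CARD('d) + 3) div 2"
proof -
  have "card (Inl ` {S :: 'd set. card S = 1 \<or> card S = 2} \<union> range (Inr :: 'd \<Rightarrow> _))
      = CARD('d) * (CARD('d) + 1) div 2 + CARD('d)"
    by (subst card_Un_disjoint) (auto simp: card_image card_one_or_two_element_subsets[simplified])
  then show ?thesis by (simp add: algebra_simps)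
qed

section \<open>Tverberg's theorem with volume\<close>

theorem theorem1p1:
  fixes r :: nat
    and I :: "'i set"
    and F :: "'i \<Rightarrow> (real ^ 'd) set"
  assumes "r \<ge> 1"
    and "card I = (r - 1) * (CARD('d) * (CARD('d) + 3) div 2 + 1) + 1"
    and "\<And>i. i \<in> I \<Longrightarrow> F i \<in> sets lebesgue"
    and "\<And>i. i \<in> I \<Longrightarrow> emeasure lebesgue (F i) = 1"
  shows "\<exists>P. partition_on I P \<and> card P = r \<and>
           emeasure lebesgue (\<Inter>A\<in>P. convex hull (\<Union>i\<in>A. F i))
             \<ge> ennreal (1 / real CARD('d) ^ CARD('d))"
proof -
  let ?d = "CARD('d)" and ?\<omega> = "unit_ball_vol (real CARD('d))"
  have "finite I" using assms(2) by (metis add_is_0 card.infinite one_neq_zero)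
  have "\<exists>A a. positive_semidefinite A \<and> 1 / real ?d ^ ?d \<le> det A * ?\<omega> \<and>
      (\<lambda>y. a + A *v y) ` ball 0 1 \<subseteq> convex hull F i" if "i \<in> I" for i
    using inscribed_ellipsoid_of_volume[OF assms(3,4)[OF that]] by metis
  then obtain A a where A: "\<And>i. i \<in> I \<Longrightarrow> positive_semidefinite (A i)"
      "\<And>i. i \<in> I \<Longrightarrow> 1 / real ?d ^ ?d \<le> det (A i) * ?\<omega>"
      "\<And>i. i \<in> I \<Longrightarrow> (\<lambda>y. a i + A i *v y) ` ball 0 1 \<subseteq> convex hull F i"
    by metis
  define B where "B = Inl ` {S :: 'd set. card S = 1 \<or> card S = 2} \<union> range (Inr :: 'd \<Rightarrow> 'd set + 'd)"
  have "finite B" by (simp add: B_def)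
  moreover have "(r - 1) * (card B + 1) < card I"
    unfolding B_def card_ellipsoid_coordinates using assms(2) by simp
  ultimately obtain f \<alpha> z where f: "\<And>i. i \<in> I \<Longrightarrow> f i < r" "\<And>i. i \<in> I \<Longrightarrow> 0 \<le> \<alpha> i"
    and one: "\<And>j. j < r \<Longrightarrow> sum \<alpha> {i\<in>I. f i = j} = 1"
    and z: "\<And>j b. j < r \<Longrightarrow> b \<in> B \<Longrightarrow>
      (\<Sum>i | i \<in> I \<and> f i = j. \<alpha> i * ellipsoid_coordinate (A i) (a i) b) = z b"
    using tverberg_coordinates[OF _ \<open>finite I\<close> assms(1), of B "\<lambda>i. ellipsoid_coordinate (A i) (a i)"]
    by blast
  define part where "part j = {i\<in>I. f i = j}" for j
  \<comment> \<open>The common Tverberg point read back as a matrix and a centre; the sums over all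
    parts agree with it.\<close>
  define S where "S = (\<chi> p q. z (Inl {p, q}))"
  define s where "s = (\<chi> p. z (Inr p))"
  have S: "(\<Sum>i\<in>part j. \<alpha> i *\<^sub>R A i) = S" if "j < r" for j
  proof -
    have "(\<Sum>i\<in>part j. \<alpha> i * A i $ p $ q) = z (Inl {p, q})" for p q
    proof -
      have "Inl {p, q} \<in> B" by (cases "p = q") (auto simp: B_def)
      from z[OF that this] show ?thesis
        using A(1) by (simp add: part_def ellipsoid_coordinate_Inl positive_semidefinite_def)
    qed
    then show ?thesis by (simp add: vec_eq_iff S_def)
  qed
  have s: "(\<Sum>i\<in>part j. \<alpha> i *\<^sub>R a i) = s" if "j < r" for j
    using z[OF that, of "Inr _"] by (simp add: vec_eq_iff s_def part_def B_def ellipsoid_coordinate_def)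
  have part: "finite (part j)" "part j \<subseteq> I" for j using \<open>finite I\<close> by (auto simp: part_def)
  \<comment> \<open>The required volume divided by that of the unit ball, that is, the lower bound
    for determinants. Part 0 exists because \<open>r\<close> is positive, and it is enough because
    every part yields the same \<open>S\<close>.\<close>
  define \<kappa> where "\<kappa> = 1 / real ?d ^ ?d / ?\<omega>"
  have "\<kappa> > 0" by (simp add: \<kappa>_def)
  have "\<kappa> \<le> det (\<Sum>i\<in>part 0. \<alpha> i *\<^sub>R A i)"
  proof (rule det_convex_combination_ge)
    fix i assume "i \<in> part 0"
    then have "i \<in> I" by (simp add: part_def)
    then show "0 \<le> \<alpha> i" "positive_semidefinite (A i)" by (auto simp: f A)
    show "\<kappa> \<le> det (A i)" using A(2)[OF \<open>i \<in> I\<close>] by (simp add: \<kappa>_def divide_le_eq mult_ac)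
  qed (use one[of 0] assms(1) part \<open>\<kappa> > 0\<close> in \<open>auto simp: part_def\<close>)
  then have detS: "\<kappa> \<le> det S" using S[of 0] assms(1) by simp
  define E where "E = (\<lambda>y. s + S *v y) ` ball 0 1"
  have E: "E \<in> lmeasurable" "measure lebesgue E = det S * ?\<omega>"
    using detS \<open>\<kappa> > 0\<close> unfolding E_def
    by (simp_all add: lmeasurable_affine_image measure_affine_image content_ball)
  have E_sub: "E \<subseteq> convex hull (\<Union>i\<in>part j. F i)" if "j < r" for j
  proof
    fix x assume "x \<in> E"
    then obtain y where y: "y \<in> ball 0 1" "x = s + S *v y" by (auto simp: E_def)
    \<comment> \<open>The same \<open>y\<close> is used in every ellipsoid of the part, so the point
      is a convex combination of points of the individual hulls.\<close>
    have "x = (\<Sum>i\<in>part j. \<alpha> i *\<^sub>R (a i + A i *v y))"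
      by (simp add: y(2) S[OF that, symmetric] s[OF that, symmetric] matrix_vector_mult_sum_left
          scaleR_add_right sum.distrib)
    also have "\<dots> \<in> convex hull (\<Union>i\<in>part j. F i)"
    proof (rule convex_sum)
      fix i assume i: "i \<in> part j"
      then have "i \<in> I" by (simp add: part_def)
      then show "0 \<le> \<alpha> i" by (rule f)
      have "a i + A i *v y \<in> convex hull F i" using A(3)[OF \<open>i \<in> I\<close>] y(1) by blast
      moreover have "convex hull F i \<subseteq> convex hull (\<Union>i\<in>part j. F i)"
        using i by (intro hull_mono) auto
      ultimately show "a i + A i *v y \<in> convex hull (\<Union>i\<in>part j. F i)" by blast
    qed (use one[OF that] part in \<open>auto simp: part_def convex_convex_hull\<close>)
    finally show "x \<in> convex hull (\<Union>i\<in>part j. F i)" .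
  qed
  define P where "P = part ` {..<r}"
  \<comment> \<open>Weights summing to 1 rule out an empty part; nonempty disjoint parts are
    distinct, so there are exactly \<open>r\<close> of them.\<close>
  have nonempty: "part j \<noteq> {}" if "j < r" for j
    using one[OF that] by (metis part_def sum.empty zero_neq_one)
  have "partition_on I P"
    using f(1) nonempty by (auto simp: partition_on_def P_def disjoint_def part_def)
  moreover have "inj_on part {..<r}"
  proof (rule inj_onI)
    fix j k assume jk: "j \<in> {..<r}" "k \<in> {..<r}" "part j = part k"
    then obtain i where "i \<in> part j" using nonempty by blast
    moreover from this jk have "i \<in> part k" by simp
    ultimately show "j = k" by (simp add: part_def)
  qed
  then have "card P = r" by (simp add: P_def card_image)
  moreover have "ennreal (1 / real ?d ^ ?d) \<le> emeasure lebesgue (\<Inter>A\<in>P. convex hull (\<Union>i\<in>A. F i))"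
  proof -
    have "1 / real ?d ^ ?d \<le> det S * ?\<omega>" using detS by (simp add: \<kappa>_def divide_le_eq mult_ac)
    then have "ennreal (1 / real ?d ^ ?d) \<le> emeasure lebesgue E"
      using E by (simp add: emeasure_eq_measure2 ennreal_leI)
    also have "\<dots> \<le> emeasure lebesgue (\<Inter>A\<in>P. convex hull (\<Union>i\<in>A. F i))"
      using E_sub by (intro emeasure_mono convex_imp_lebesgue_measurable convex_INT convex_convex_hull)
        (auto simp: P_def)
    finally show ?thesis .
  qed
  ultimately show ?thesis by blast
qed

end
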